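(* Let $\mathbf{X}$ be a computably compact computable metric space, and let $\circ:\mathbf{X}\times\mathbf{X}\to\mathbf{X}$ be a computable operation making $\mathbf{X}$ a (compact topological) group. Then the Haar measure $\mu$ of this group, i.e. the unique left-invariant Borel probability measure on $\mathbf{X}$, is computable as an element of $\mathcal{PM}(\mathbf{X})$.
   Context: Computable analysis via represented spaces. A computable metric space is a complete metric space $(X,d)$ with a designated dense sequence on which $d$ is computable; points are represented as limits of fast converging sequences from it. $\mathcal{O}(\mathbf{X})$ is the represented space of open subsets (membership is semi-decidable). $\mathbf{X}$ is computably compact if universal quantification over $\mathbf{X}$ preserves computable open predicates (equivalently, $\{U\in\mathcal{O}(\mathbf{X}) : U=X\}$ is semi-decidable). $\mathbb{R}_<$ denotes the lower reals (a real represented as the supremum of a sequence of rationals). $\mathcal{PM}(\mathbf{X})$ is the space of Borel probability measures on $\mathbf{X}$, represented as the subspace of $\mathcal{C}(\mathcal{O}(\mathbf{X}),\mathbb{R}_<)$, $\mu\mapsto(U\mapsto\mu(U))$. Computability of $\mu$ means that $\mu(U)$ can be approximated from below uniformly in $U\in\mathcal{O}(\mathbf{X})$. *)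

theory Defs
  imports "HOL-Probability.Probability" "HOL-Library.Nat_Bijection"
begin

type_synonym baire = "nat \<Rightarrow> nat"

section \<open>Computability relative to an oracle\<close>

text \<open>Codes for the partial recursive functions relative to an oracle in Baire space.
  Argument lists that are too short make a function undefined, superfluous arguments are
  ignored.\<close>

datatype prog =
    Zero
  | Succ
  | Proj nat
  | Oracle
  | Comp prog "prog list"
  | Prec prog prog
  | Mu prog

fun ev :: "prog \<Rightarrow> baire \<Rightarrow> nat list \<Rightarrow> nat option" where
  "ev Zero p xs = Some 0"
| "ev Succ p xs = (case xs of [] \<Rightarrow> None | x # _ \<Rightarrow> Some (Suc x))"
| "ev (Proj i) p xs = (if i < length xs then Some (xs ! i) else None)"
| "ev Oracle p xs = (case xs of [] \<Rightarrow> None | x # _ \<Rightarrow> Some (p x))"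
| "ev (Comp f gs) p xs = Option.bind (those (map (\<lambda>g. ev g p xs) gs)) (ev f p)"
| "ev (Prec f g) p xs =
     (case xs of
        [] \<Rightarrow> None
      | n # ys \<Rightarrow>
          rec_nat (ev f p ys) (\<lambda>m r. Option.bind r (\<lambda>v. ev g p (m # v # ys))) n)"
| "ev (Mu f) p xs =
     (if \<exists>n. ev f p (n # xs) = Some 0 \<and> (\<forall>m<n. \<exists>v. ev f p (m # xs) = Some (Suc v))
      then Some (LEAST n. ev f p (n # xs) = Some 0)
      else None)"

definition computable_seq :: "baire \<Rightarrow> bool" where
  "computable_seq q \<longleftrightarrow> (\<exists>e. \<forall>n. ev e (\<lambda>_. 0) [n] = Some (q n))"


section \<open>Represented spaces\<close>

text \<open>A representation is a partial map from Baire space; the represented set is its range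
  \<^term>\<open>ran \<delta>\<close>.\<close>

type_synonym 'a rep = "baire \<Rightarrow> 'a option"

definition rep_of :: "(baire \<Rightarrow> 'a \<Rightarrow> bool) \<Rightarrow> 'a rep" where
  "rep_of R p = (if \<exists>!x. R p x then Some (THE x. R p x) else None)"

lemma rep_of_eq_Some_iff:
  assumes "\<And>x y. R p x \<Longrightarrow> R p y \<Longrightarrow> x = y"
  shows "rep_of R p = Some x \<longleftrightarrow> R p x"
proof
  assume "rep_of R p = Some x"
  then have ex: "\<exists>!x. R p x" and the: "(THE x. R p x) = x"
    unfolding rep_of_def by (simp_all split: if_splits)
  from theI'[OF ex] show "R p x" unfolding the .
next
  assume "R p x"
  moreover from this have "(THE x. R p x) = x" using assms by (intro the_equality)
  ultimately have "\<exists>!x. R p x" "(THE x. R p x) = x" using assms by auto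
  then show "rep_of R p = Some x" by (simp add: rep_of_def)
qed

definition computable_point :: "'a rep \<Rightarrow> 'a \<Rightarrow> bool" where
  "computable_point \<delta> x \<longleftrightarrow> (\<exists>p. computable_seq p \<and> \<delta> p = Some x)"

definition computable_map :: "'a rep \<Rightarrow> 'b rep \<Rightarrow> ('a \<Rightarrow> 'b) \<Rightarrow> bool" where
  "computable_map \<delta> \<delta>' f \<longleftrightarrow>
     (\<exists>e. \<forall>p x. \<delta> p = Some x \<longrightarrow>
        (\<exists>q. (\<forall>n. ev e p [n] = Some (q n)) \<and> \<delta>' q = Some (f x)))"

definition nat_rep :: "nat rep" where
  "nat_rep p = Some (p 0)"

definition prod_rep :: "'a rep \<Rightarrow> 'b rep \<Rightarrow> ('a \<times> 'b) rep" where
  "prod_rep \<delta> \<delta>' p =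
     Option.bind (\<delta> (\<lambda>n. p (2 * n))) (\<lambda>x.
       map_option (Pair x) (\<delta>' (\<lambda>n. p (2 * n + 1))))"

text \<open>Sierpinski space, with \<^const>\<open>True\<close> as its open point.\<close>

definition sierpinski_rep :: "bool rep" where
  "sierpinski_rep p = Some (\<exists>n. p n \<noteq> 0)"

text \<open>Points are named by sequences converging to them with rate \<open>2\<^sup>-\<^sup>n\<close>.\<close>

definition metric_rep :: "(nat \<Rightarrow> 'a::metric_space) \<Rightarrow> 'a rep" where
  "metric_rep a = rep_of (\<lambda>p x. \<forall>n. dist (a (p n)) x < 1 / 2 ^ n)"

lemma metric_rep_iff: "metric_rep a p = Some x \<longleftrightarrow> (\<forall>n. dist (a (p n)) x < 1 / 2 ^ n)"
  unfolding metric_rep_def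
proof (rule rep_of_eq_Some_iff)
  fix x y assume x: "\<forall>n. dist (a (p n)) x < 1 / 2 ^ n" and y: "\<forall>n. dist (a (p n)) y < 1 / 2 ^ n"
  have lim: "(\<lambda>n. 1 / 2 ^ n :: real) \<longlonglongrightarrow> 0"
    using LIMSEQ_realpow_zero[of "1 / 2 :: real"] by (simp add: power_one_over)
  have "(\<lambda>n. dist (a (p n)) z) \<longlonglongrightarrow> 0" if "\<forall>n. dist (a (p n)) z < 1 / 2 ^ n" for z
    using that by (intro real_tendsto_sandwich[OF _ _ tendsto_const lim] always_eventually allI)
      (simp_all add: less_imp_le)
  then have "(\<lambda>n. a (p n)) \<longlonglongrightarrow> x" "(\<lambda>n. a (p n)) \<longlonglongrightarrow> y"
    using x y by (simp_all add: tendsto_dist_iff[of _ x] tendsto_dist_iff[of _ y])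
  then show "x = y" by (rule LIMSEQ_unique)
qed

definition rat_seq :: "nat \<Rightarrow> real" where
  "rat_seq n = (case prod_decode n of (k, m) \<Rightarrow> real_of_int (int_decode k) / real (Suc m))"

definition real_rep :: "real rep" where
  "real_rep = metric_rep rat_seq"

definition lower_real_rep :: "real rep" where
  "lower_real_rep p =
     (if bdd_above (range (\<lambda>n. rat_seq (p n))) then Some (SUP n. rat_seq (p n)) else None)"

text \<open>Application of Kleene's second algebra: \<open>u\<close> is read as an associate of a partial
  continuous function on Baire space. A value \<open>0\<close> asks for a longer prefix of the argument
  \<open>p\<close>, and a value \<open>Suc v\<close> announces the output \<open>v\<close> at position \<open>n\<close>.\<close>

definition assoc_app :: "baire \<Rightarrow> baire \<Rightarrow> nat \<Rightarrow> nat option" where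
  "assoc_app u p n =
     (let w = (\<lambda>k. u (prod_encode (n, list_encode (map p [0..<k]))))
      in if \<exists>k. w k \<noteq> 0 then Some (w (LEAST k. w k \<noteq> 0) - 1) else None)"

text \<open>The space of continuous functions. Functions are normalised to be
  \<^const>\<open>undefined\<close> outside the represented set, which makes a name determine its function.\<close>

definition fun_rep :: "'a rep \<Rightarrow> 'b rep \<Rightarrow> ('a \<Rightarrow> 'b) rep" where
  "fun_rep \<delta> \<delta>' = rep_of (\<lambda>u f. f \<in> extensional (ran \<delta>) \<and>
     (\<forall>p x. \<delta> p = Some x \<longrightarrow>
        (\<exists>q. (\<forall>n. assoc_app u p n = Some (q n)) \<and> \<delta>' q = Some (f x))))"

lemma fun_rep_iff:
  fixes \<delta> :: "'a rep" and \<delta>' :: "'b rep"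
  shows "fun_rep \<delta> \<delta>' u = Some f \<longleftrightarrow> f \<in> extensional (ran \<delta>) \<and>
     (\<forall>p x. \<delta> p = Some x \<longrightarrow>
        (\<exists>q. (\<forall>n. assoc_app u p n = Some (q n)) \<and> \<delta>' q = Some (f x)))"
  unfolding fun_rep_def
proof (rule rep_of_eq_Some_iff, elim conjE)
  fix f g :: "'a \<Rightarrow> 'b"
  assume ext: "f \<in> extensional (ran \<delta>)" "g \<in> extensional (ran \<delta>)"
  assume f: "\<forall>p x. \<delta> p = Some x \<longrightarrow>
      (\<exists>q. (\<forall>n. assoc_app u p n = Some (q n)) \<and> \<delta>' q = Some (f x))"
  assume g: "\<forall>p x. \<delta> p = Some x \<longrightarrow>
      (\<exists>q. (\<forall>n. assoc_app u p n = Some (q n)) \<and> \<delta>' q = Some (g x))"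
  show "f = g"
  proof (rule extensionalityI[OF ext])
    fix x assume "x \<in> ran \<delta>"
    then obtain p where p: "\<delta> p = Some x" by (auto simp: ran_def)
    from f p obtain q where q: "\<And>n. assoc_app u p n = Some (q n)" "\<delta>' q = Some (f x)" by blast
    from g p obtain r where r: "\<And>n. assoc_app u p n = Some (r n)" "\<delta>' r = Some (g x)" by blast
    have "q = r"
    proof
      fix n show "q n = r n" using q(1)[of n] r(1)[of n] by simp
    qed
    then show "f x = g x" using q(2) r(2) by simp
  qed
qed

text \<open>Open sets are identified with the continuous maps into Sierpinski space.\<close>

definition open_rep :: "'a rep \<Rightarrow> 'a set rep" where
  "open_rep \<delta> u = map_option (\<lambda>f. {x \<in> ran \<delta>. f x}) (fun_rep \<delta> sierpinski_rep u)"

definition computably_compact :: "'a rep \<Rightarrow> bool" where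
  "computably_compact \<delta> \<longleftrightarrow>
     computable_map (open_rep \<delta>) sierpinski_rep (\<lambda>U. U = ran \<delta>)"

definition prob_measure_rep :: "'a::topological_space rep \<Rightarrow> 'a measure rep" where
  "prob_measure_rep \<delta> = rep_of (\<lambda>u \<mu>. prob_space \<mu> \<and> sets \<mu> = sets borel \<and>
     fun_rep (open_rep \<delta>) lower_real_rep u =
       Some (restrict (\<lambda>U. measure \<mu> U) (ran (open_rep \<delta>))))"


section \<open>Computable metric spaces and Haar measure\<close>

definition computable_metric_space :: "(nat \<Rightarrow> 'a::complete_space) \<Rightarrow> bool" where
  "computable_metric_space a \<longleftrightarrow>
     closure (range a) = UNIV \<and>
     computable_map (prod_rep nat_rep nat_rep) real_rep (\<lambda>(i, j). dist (a i) (a j))"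

definition haar_prob_measure ::
    "('a::topological_space \<Rightarrow> 'a \<Rightarrow> 'a) \<Rightarrow> 'a measure \<Rightarrow> bool" where
  "haar_prob_measure mul \<mu> \<longleftrightarrow>
     prob_space \<mu> \<and> sets \<mu> = sets borel \<and>
     (\<forall>g. \<forall>A \<in> sets borel. emeasure \<mu> (mul g ` A) = emeasure \<mu> A)"

end

theory Submission
  imports Defs
begin

text \<open>For an open set \<open>U\<close> and elements \<open>g\<^sub>1, \<dots>, g\<^sub>k\<close> such that every point is moved into
  \<open>U\<close> by at least \<open>m\<close> of them, integrating the sum of the indicators of \<open>g\<^sub>i x \<in> U\<close> gives
  \<open>m / k \<le> \<mu>(U)\<close>. Conversely \<open>\<mu>(U)\<close> is the supremum of these quotients, even with all \<open>g\<^sub>i\<close> in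
  the dense sequence: a discrete approximation of the image of \<open>\<mu>\<close> under inversion is almost
  invariant under right translation. By computable compactness the condition on \<open>m\<close> and the
  \<open>g\<^sub>i\<close> is semi-decidable from a name of \<open>U\<close>, so \<open>\<mu>(U)\<close> can be enumerated from below. No
  universal machine is needed: only the two given programs are run, and for a fixed program
  evaluation with bounded resources is a total computable function.\<close>

text \<open>A name of \<open>\<mu>\<close> is an associate: a total function that answers from a
  finite prefix of a name of \<open>U\<close>. The compactness program, however, confirms equality
  only at some unknown output position, after reading an unknown part of its oracle. Hence every
  index of the output sequence carries its own resource bound, and an unsuccessful run outputs 0,
  which is harmless below a supremum of nonnegative numbers. The oracle of that program is again an
  associate, obtained by running the multiplication program on prefixes; the bounds are tied
  together so that a run with bound \<open>N\<close> uses only the first \<open>N\<close> values of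
  the name of \<open>U\<close>. The hypotheses speak of computability only. Compactness and
  continuity of multiplication are extracted from the fact that a halting run uses finitely many
  oracle entries; continuity of inversion then follows from compactness.\<close>

section \<open>Total computable functions\<close>

text \<open>Only unary functions are treated: further parameters are packed into the argument by
  pairing, and predicates enter as \<open>of_bool\<close> functions. The closure rules then work as
  introduction rules without tracking arities.\<close>

definition tcomp :: "(nat \<Rightarrow> nat) \<Rightarrow> bool" where
  "tcomp f \<longleftrightarrow> (\<exists>c. \<forall>p n. ev c p [n] = Some (f n))"

named_theorems tcomp_intros

lemma tcomp_const [tcomp_intros]: "tcomp (\<lambda>_. k)"
proof (induction k)
  case 0
  have "ev Zero p [n] = Some 0" for p n by simp
  then show ?case unfolding tcomp_def by blast
next
  case (Suc k)
  then obtain c where "\<And>p n. ev c p [n] = Some k" unfolding tcomp_def by blast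
  then have "ev (Comp Succ [c]) p [n] = Some (Suc k)" for p n by simp
  then show ?case unfolding tcomp_def by blast
qed

lemma tcomp_id [tcomp_intros]: "tcomp (\<lambda>x. x)"
proof -
  have "ev (Proj 0) p [n] = Some n" for p n by simp
  then show ?thesis unfolding tcomp_def by blast
qed

lemma tcomp_comp:
  assumes "tcomp f" "tcomp g"
  shows "tcomp (\<lambda>x. f (g x))"
proof -
  obtain c d where "\<And>p n. ev c p [n] = Some (f n)" "\<And>p n. ev d p [n] = Some (g n)"
    using assms unfolding tcomp_def by metis
  then have "ev (Comp c [d]) p [n] = Some (f (g n))" for p n by simp
  then show ?thesis unfolding tcomp_def by blast
qed

lemma tcomp_binary:
  assumes "\<And>p x y. ev c p [x, y] = Some (h x y)" "tcomp f" "tcomp g"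
  shows "tcomp (\<lambda>x. h (f x) (g x))"
proof -
  obtain a b where "\<And>p n. ev a p [n] = Some (f n)" "\<And>p n. ev b p [n] = Some (g n)"
    using assms(2,3) unfolding tcomp_def by metis
  then have "ev (Comp c [a, b]) p [n] = Some (h (f n) (g n))" for p n using assms(1) by simp
  then show ?thesis unfolding tcomp_def by blast
qed

lemma tcomp_Suc [tcomp_intros]: "tcomp f \<Longrightarrow> tcomp (\<lambda>x. Suc (f x))"
proof (rule tcomp_comp[of Suc])
  have "ev Succ p [n] = Some (Suc n)" for p n by simp
  then show "tcomp Suc" unfolding tcomp_def by blast
qed

definition add_prog :: prog where "add_prog = Prec (Proj 0) (Comp Succ [Proj 1])"

lemma ev_add_prog: "ev add_prog p [x, y] = Some (x + y)"
  unfolding add_prog_def by (induction x) simp_all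

lemma tcomp_add [tcomp_intros]: "tcomp f \<Longrightarrow> tcomp g \<Longrightarrow> tcomp (\<lambda>x. f x + g x)"
  by (rule tcomp_binary[OF ev_add_prog])

lemma ev_pred_prog: "ev (Prec Zero (Proj 0)) p (x # xs) = Some (x - 1)"
  by (induction x) simp_all

text \<open>\<open>Prec\<close> recurses on its first argument, so the subtrahend comes
  first.\<close>

definition diff_prog :: prog where
  "diff_prog = Prec (Proj 0) (Comp (Prec Zero (Proj 0)) [Proj 1])"

lemma ev_diff_prog: "ev diff_prog p [x, y] = Some (y - x)"
proof (induction x)
  case 0
  then show ?case by (simp add: diff_prog_def)
next
  case (Suc x)
  then show ?case using ev_pred_prog[of p "y - x" "[]"] by (simp add: diff_prog_def)
qed

lemma tcomp_diff [tcomp_intros]: "tcomp f \<Longrightarrow> tcomp g \<Longrightarrow> tcomp (\<lambda>x. f x - g x)"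
  by (rule tcomp_binary[OF ev_diff_prog])

lemma tcomp_triangle [tcomp_intros]:
  assumes "tcomp f"
  shows "tcomp (\<lambda>x. triangle (f x))"
proof (rule tcomp_comp[OF _ assms])
  define c where "c = Prec Zero (Comp Succ [Comp add_prog [Proj 0, Proj 1]])"
  have "ev c p [n] = Some (triangle n)" for p n
    unfolding c_def by (induction n) (simp_all add: ev_add_prog)
  then show "tcomp triangle" unfolding tcomp_def by blast
qed

section \<open>Pairing and its projections\<close>

definition pair :: "nat \<Rightarrow> nat \<Rightarrow> nat" where "pair x y = prod_encode (x, y)"
definition pfst :: "nat \<Rightarrow> nat" where "pfst z = fst (prod_decode z)"
definition psnd :: "nat \<Rightarrow> nat" where "psnd z = snd (prod_decode z)"

lemma pfst_pair [simp]: "pfst (pair x y) = x" and psnd_pair [simp]: "psnd (pair x y) = y"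
  and pair_pfst_psnd [simp]: "pair (pfst z) (psnd z) = z"
  by (simp_all add: pair_def pfst_def psnd_def)

lemma tcomp_pair [tcomp_intros]: "tcomp f \<Longrightarrow> tcomp g \<Longrightarrow> tcomp (\<lambda>x. pair (f x) (g x))"
  unfolding pair_def prod_encode_def by (simp add: tcomp_intros)

text \<open>The antidiagonal of the Cantor pairing on which \<open>z\<close> lies. By
  \<open>tri_root_bounds\<close> it is the least \<open>s\<close> with
  \<open>z < triangle (Suc s)\<close>, which \<open>Mu\<close> can find; both projections are then
  subtractions.\<close>

definition tri_root :: "nat \<Rightarrow> nat" where "tri_root z = pfst z + psnd z"

lemma triangle_mono: "m \<le> n \<Longrightarrow> triangle m \<le> triangle n"
  by (induction rule: dec_induct) simp_all

lemma tri_root_bounds: "triangle (tri_root z) \<le> z" "z < triangle (Suc (tri_root z))"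
proof -
  have "triangle (pfst z + psnd z) + pfst z = z"
    using prod_decode_inverse[of z]
    by (simp add: pfst_def psnd_def prod_encode_def split_beta del: prod_decode_inverse)
  then show "triangle (tri_root z) \<le> z" "z < triangle (Suc (tri_root z))"
    unfolding tri_root_def triangle_Suc by linarith+
qed

lemma pfst_eq: "pfst z = z - triangle (tri_root z)"
  using prod_decode_inverse[of z]
  by (simp add: tri_root_def pfst_def psnd_def prod_encode_def split_beta del: prod_decode_inverse)

lemma psnd_eq: "psnd z = tri_root z - pfst z"
  by (simp add: tri_root_def)

lemma tcomp_tri_root: "tcomp tri_root"
proof -
  obtain tri where tri: "\<And>p n. ev tri p [n] = Some (triangle n)"
    using tcomp_triangle[OF tcomp_id] unfolding tcomp_def by blast
  define body where "body = Comp diff_prog [Comp tri [Comp Succ [Proj 0]], Comp Succ [Proj 1]]"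
  have body: "ev body p [s, z] = Some (Suc z - triangle (Suc s))" for p s z
    unfolding body_def by (simp add: tri ev_diff_prog)
  have "ev (Mu body) p [z] = Some (tri_root z)" for p z
  proof -
    have 1: "ev body p [tri_root z, z] = Some 0"
      using tri_root_bounds[of z] by (simp add: body)
    have 2: "\<exists>v. ev body p [m, z] = Some (Suc v)" if "m < tri_root z" for m
    proof -
      have "triangle (Suc m) \<le> z"
        using triangle_mono[of "Suc m" "tri_root z"] that tri_root_bounds[of z] by simp
      then show ?thesis by (auto simp: body intro!: exI[of _ "z - triangle (Suc m)"])
    qed
    have "(LEAST n. ev body p [n, z] = Some 0) = tri_root z"
      using 1 2 by (intro Least_equality) (auto simp: not_less[symmetric], fastforce)
    then show ?thesis using 1 2 by auto
  qed
  then show ?thesis unfolding tcomp_def by blast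
qed

lemma tcomp_pfst [tcomp_intros]: "tcomp f \<Longrightarrow> tcomp (\<lambda>x. pfst (f x))"
  unfolding pfst_eq by (intro tcomp_intros tcomp_comp[OF tcomp_tri_root])

lemma tcomp_psnd [tcomp_intros]: "tcomp f \<Longrightarrow> tcomp (\<lambda>x. psnd (f x))"
  unfolding psnd_eq by (intro tcomp_intros tcomp_comp[OF tcomp_tri_root])

lemma tcomp_rec [tcomp_intros]:
  assumes "tcomp f" "tcomp (\<lambda>z. g (pfst z) (pfst (psnd z)) (psnd (psnd z)))" "tcomp n"
  shows "tcomp (\<lambda>x. rec_nat (f x) (g x) (n x))"
proof -
  obtain cf cg cn where cf: "\<And>p n. ev cf p [n] = Some (f n)"
    and cg: "\<And>p z. ev cg p [z] = Some (g (pfst z) (pfst (psnd z)) (psnd (psnd z)))"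
    and cn: "\<And>p x. ev cn p [x] = Some (n x)"
    using assms unfolding tcomp_def by metis
  obtain pr where pr: "\<And>p x y. ev pr p [x, y] = Some (pair x y)"
  proof -
    obtain t where t: "\<And>p n. ev t p [n] = Some (triangle n)"
      using tcomp_triangle[OF tcomp_id] unfolding tcomp_def by blast
    have "ev (Comp add_prog [Comp t [add_prog], Proj 0]) p [x, y] = Some (pair x y)" for p x y
      by (simp add: t ev_add_prog pair_def prod_encode_def)
    then show ?thesis using that by blast
  qed
  \<comment> \<open>\<open>Prec\<close> hands the list \<open>[m, v, x]\<close> to its step program;
    the projections repack it as the triple that \<open>cg\<close> expects, with the parameter
    \<open>x\<close> in front.\<close>
  define c where "c = Comp (Prec cf (Comp cg [Comp pr [Proj 2, Comp pr [Proj 0, Proj 1]]])) [cn, Proj 0]"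
  have "rec_nat (Some (f x)) (\<lambda>m r. Option.bind r (\<lambda>v.
      ev (Comp cg [Comp pr [Proj 2, Comp pr [Proj 0, Proj 1]]]) p [m, v, x])) k
    = Some (rec_nat (f x) (g x) k)" for p x k
    by (induction k) (simp_all add: pr cg)
  then have "ev c p [x] = Some (rec_nat (f x) (g x) (n x))" for p x
    unfolding c_def by (simp add: cf cn)
  then show ?thesis unfolding tcomp_def by blast
qed

text \<open>A case distinction is a recursion whose number of rounds is the truth value of the
  condition.\<close>

lemma tcomp_if [tcomp_intros]:
  assumes "tcomp (\<lambda>x. of_bool (P x))" "tcomp f" "tcomp g"
  shows "tcomp (\<lambda>x. if P x then f x else g x)"
proof -
  have "tcomp (\<lambda>x. rec_nat (g x) (\<lambda>_ _. f x) (of_bool (P x)))"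
    by (intro tcomp_intros assms tcomp_comp[OF assms(2)])
  moreover have "(\<lambda>x. rec_nat (g x) (\<lambda>_ _. f x) (of_bool (P x))) = (\<lambda>x. if P x then f x else g x)"
    by auto
  ultimately show ?thesis by simp
qed

lemma tcomp_of_bool_le [tcomp_intros]:
  assumes "tcomp f" "tcomp g" shows "tcomp (\<lambda>x. of_bool (f x \<le> g x))"
proof -
  have "tcomp (\<lambda>x. 1 - (f x - g x))" by (intro tcomp_intros assms)
  moreover have "(\<lambda>x. 1 - (f x - g x)) = (\<lambda>x. of_bool (f x \<le> g x))" by (auto simp: fun_eq_iff)
  ultimately show ?thesis by simp
qed

lemma tcomp_of_bool_less [tcomp_intros]:
  assumes "tcomp f" "tcomp g" shows "tcomp (\<lambda>x. of_bool (f x < g x))"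
  using tcomp_of_bool_le[OF tcomp_Suc[OF assms(1)] assms(2)] by (simp add: Suc_le_eq)

lemma tcomp_of_bool_not [tcomp_intros]:
  assumes "tcomp (\<lambda>x. of_bool (P x))" shows "tcomp (\<lambda>x. of_bool (\<not> P x))"
proof -
  have "tcomp (\<lambda>x. 1 - of_bool (P x))" by (intro tcomp_intros assms)
  moreover have "(\<lambda>x. 1 - of_bool (P x)) = (\<lambda>x. of_bool (\<not> P x) :: nat)" by auto
  ultimately show ?thesis by simp
qed

lemma tcomp_of_bool_conj [tcomp_intros]:
  assumes "tcomp (\<lambda>x. of_bool (P x))" "tcomp (\<lambda>x. of_bool (Q x))"
  shows "tcomp (\<lambda>x. of_bool (P x \<and> Q x))"
proof -
  have "tcomp (\<lambda>x. if P x then of_bool (Q x) else 0)" by (intro tcomp_intros assms)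
  moreover have "(\<lambda>x. if P x then of_bool (Q x) else 0) = (\<lambda>x. of_bool (P x \<and> Q x) :: nat)" by auto
  ultimately show ?thesis by simp
qed

lemma tcomp_of_bool_disj [tcomp_intros]:
  assumes "tcomp (\<lambda>x. of_bool (P x))" "tcomp (\<lambda>x. of_bool (Q x))"
  shows "tcomp (\<lambda>x. of_bool (P x \<or> Q x))"
proof -
  have "tcomp (\<lambda>x. if P x then 1 else of_bool (Q x))" by (intro tcomp_intros assms)
  moreover have "(\<lambda>x. if P x then 1 else of_bool (Q x)) = (\<lambda>x. of_bool (P x \<or> Q x) :: nat)" by auto
  ultimately show ?thesis by simp
qed

lemma tcomp_of_bool_eq [tcomp_intros]:
  fixes f g :: "nat \<Rightarrow> nat"
  assumes "tcomp f" "tcomp g" shows "tcomp (\<lambda>x. of_bool (f x = g x))"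
  unfolding order_eq_iff by (intro tcomp_intros assms)

section \<open>Bounded sums, quantifiers and minima\<close>

lemma tcomp_sum [tcomp_intros]:
  assumes "tcomp (\<lambda>z. f (pfst z) (psnd z))" "tcomp n"
  shows "tcomp (\<lambda>x. \<Sum>i<n x. f x i)"
proof -
  have "tcomp (\<lambda>z. f (pfst z) (pfst (psnd z)))"
    using tcomp_comp[OF assms(1) tcomp_pair[OF tcomp_pfst[OF tcomp_id]
      tcomp_pfst[OF tcomp_psnd[OF tcomp_id]]]] by simp
  then have "tcomp (\<lambda>x. rec_nat 0 (\<lambda>m r. r + f x m) (n x))"
    by (intro tcomp_intros assms)
  moreover have "rec_nat 0 (\<lambda>m r. r + f x m) k = (\<Sum>i<k. f x i)" for x k
    by (induction k) simp_all
  ultimately show ?thesis by simp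
qed

lemma tcomp_of_bool_ex [tcomp_intros]:
  assumes "tcomp (\<lambda>z. of_bool (P (pfst z) (psnd z)))" "tcomp n"
  shows "tcomp (\<lambda>x. of_bool (\<exists>i<n x. P x i))"
proof -
  have "tcomp (\<lambda>x. of_bool (0 < (\<Sum>i<n x. of_bool (P x i) :: nat)))"
    by (intro tcomp_intros assms)
  moreover have "(0 < (\<Sum>i<n x. of_bool (P x i) :: nat)) \<longleftrightarrow> (\<exists>i<n x. P x i)" for x
    by (auto simp: zero_less_iff_neq_zero)
  ultimately show ?thesis by simp
qed

lemma tcomp_of_bool_all [tcomp_intros]:
  assumes "tcomp (\<lambda>z. of_bool (P (pfst z) (psnd z)))" "tcomp n"
  shows "tcomp (\<lambda>x. of_bool (\<forall>i<n x. P x i))"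
proof -
  have "tcomp (\<lambda>x. of_bool (\<not> (\<exists>i<n x. \<not> P x i)))"
    by (intro tcomp_intros assms)
  then show ?thesis by simp
qed

text \<open>The minimum is the number of \<open>j < n x\<close> such that \<open>P\<close> fails at
  every index up to \<open>j\<close>, so it is a bounded sum. The disjunct
  \<open>n x \<le> i\<close> makes an unsuccessful search return its bound.\<close>

lemma tcomp_Least:
  assumes "tcomp (\<lambda>z. of_bool (P (pfst z) (psnd z)))" "tcomp n"
  shows "tcomp (\<lambda>x. LEAST i. n x \<le> i \<or> P x i)"
proof -
  have "tcomp (\<lambda>z. of_bool (P (pfst (pfst z)) (psnd z)))"
    using tcomp_comp[OF assms(1) tcomp_pair[OF tcomp_pfst[OF tcomp_pfst[OF tcomp_id]]
      tcomp_psnd[OF tcomp_id]]] by simp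
  then have "tcomp (\<lambda>x. \<Sum>j<n x. of_bool (\<forall>i<Suc j. \<not> P x i))"
    by (intro tcomp_intros assms)
  moreover have "(\<Sum>j<n x. of_bool (\<forall>i<Suc j. \<not> P x i)) = (LEAST i. n x \<le> i \<or> P x i)" for x
  proof -
    define l where "l = (LEAST i. n x \<le> i \<or> P x i)"
    have l: "n x \<le> l \<or> P x l" unfolding l_def by (rule LeastI[of _ "n x"]) simp
    have l': "l \<le> i" if "n x \<le> i \<or> P x i" for i using that unfolding l_def by (rule Least_le)
    have "{..<n x} \<inter> {j. \<forall>i<Suc j. \<not> P x i} = {..<l}"
    proof (intro set_eqI iffI)
      fix j assume j: "j \<in> {..<n x} \<inter> {j. \<forall>i<Suc j. \<not> P x i}"
      have "\<not> l \<le> j" using j l by auto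
      then show "j \<in> {..<l}" by simp
    next
      fix j assume "j \<in> {..<l}"
      then have "\<not> (n x \<le> i \<or> P x i)" if "i \<le> j" for i using l'[of i] that by auto
      then show "j \<in> {..<n x} \<inter> {j. \<forall>i<Suc j. \<not> P x i}" by (auto simp: less_Suc_eq_le not_le)
    qed
    then show ?thesis unfolding l_def[symmetric] by (simp add: of_bool_def sum.If_cases)
  qed
  ultimately show ?thesis by simp
qed


section \<open>Computing with codes of lists\<close>

lemma list_encode_Cons_pair: "list_encode (x # xs) = Suc (pair x (list_encode xs))"
  by (simp add: pair_def)

declare list_encode.simps(2) [simp del]

lemma le_pair: "x \<le> pair x y" "y \<le> pair x y"
  by (simp_all add: pair_def le_prod_encode_1 le_prod_encode_2)

lemma pair_mono: "x \<le> x' \<Longrightarrow> y \<le> y' \<Longrightarrow> pair x y \<le> pair x' y'"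
  unfolding pair_def prod_encode_def by (simp add: add_mono triangle_mono)

lemma length_le_list_encode: "length xs \<le> list_encode xs"
proof (induction xs)
  case (Cons x xs)
  then show ?case using le_pair(2)[of "list_encode xs" x] by (simp add: list_encode_Cons_pair)
qed simp

lemma nth_less_list_encode: "i < length xs \<Longrightarrow> xs ! i < list_encode xs"
proof (induction xs arbitrary: i)
  case (Cons x xs)
  then show ?case
    using le_pair[of x "list_encode xs"] le_pair(2)[of "list_encode xs" x]
    by (cases i) (force simp: list_encode_Cons_pair)+
qed simp

lemma list_encode_take_le: "list_encode (take i xs) \<le> list_encode xs"
proof (induction xs arbitrary: i)
  case (Cons x xs)
  then show ?case by (cases i) (simp_all add: list_encode_Cons_pair pair_mono)
qed simp

definition tl_code :: "nat \<Rightarrow> nat" where "tl_code c = psnd (c - 1)"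

lemma pfst_0 [simp]: "pfst 0 = 0" and psnd_0 [simp]: "psnd 0 = 0"
  by (simp_all add: pfst_def psnd_def prod_decode_def prod_decode_aux.simps)

lemma tl_code_list_encode: "tl_code (list_encode xs) = list_encode (tl xs)"
  by (cases xs) (simp_all add: tl_code_def list_encode_Cons_pair)

text \<open>The default 0 makes lookup total. It also lets \<open>nth0 w\<close> act as an oracle
  that extends the finite prefix \<open>w\<close>.\<close>

definition nth0 :: "nat list \<Rightarrow> nat \<Rightarrow> nat" where
  "nth0 xs i = (if i < length xs then xs ! i else 0)"

lemma rec_tl_code: "rec_nat (list_encode xs) (\<lambda>_. tl_code) i = list_encode (drop i xs)"
  by (induction i) (simp_all add: tl_code_list_encode drop_Suc tl_drop)

lemma tcomp_tl_code [tcomp_intros]: "tcomp f \<Longrightarrow> tcomp (\<lambda>x. tl_code (f x))"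
  unfolding tl_code_def by (intro tcomp_intros)

lemma tcomp_nth0 [tcomp_intros]:
  assumes "tcomp L" "tcomp I" shows "tcomp (\<lambda>x. nth0 (list_decode (L x)) (I x))"
proof -
  have "tcomp (\<lambda>x. pfst (rec_nat (L x) (\<lambda>_. tl_code) (I x) - 1))"
    by (intro tcomp_intros assms)
  moreover have "pfst (list_encode (drop i xs) - 1) = nth0 xs i" for i xs
    by (cases "i < length xs")
      (auto simp: nth0_def Cons_nth_drop_Suc[symmetric] list_encode_Cons_pair)
  ultimately show ?thesis
    using rec_tl_code[of "list_decode (L _)"] by simp
qed

text \<open>The length counts the iterated tails that differ from 0, the code of the empty list; by
  \<open>length_le_list_encode\<close> the code itself bounds their number.\<close>

lemma tcomp_length [tcomp_intros]:
  assumes "tcomp L" shows "tcomp (\<lambda>x. length (list_decode (L x)))"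
proof -
  have "tcomp (\<lambda>z. rec_nat (L (pfst z)) (\<lambda>_. tl_code) (psnd z))"
    by (intro tcomp_intros tcomp_comp[OF assms])
  then have "tcomp (\<lambda>x. \<Sum>i<L x. of_bool (0 < rec_nat (L x) (\<lambda>_. tl_code) i))"
    by (intro tcomp_intros assms tcomp_comp[OF assms])
  moreover have "(\<Sum>i<list_encode xs. of_bool (0 < list_encode (drop i xs))) = length xs" for xs
  proof -
    have "0 < list_encode (drop i xs) \<longleftrightarrow> i < length xs" for i
      by (cases "drop i xs"; cases "i < length xs") (auto simp: list_encode_Cons_pair)
    moreover have "{..<list_encode xs} \<inter> {i. i < length xs} = {..<length xs}"
      using length_le_list_encode[of xs] by auto
    ultimately show ?thesis by (simp add: of_bool_def sum.If_cases)
  qed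
  from this[of "list_decode (L _)"]
  have "(\<Sum>i<L x. of_bool (0 < rec_nat (L x) (\<lambda>_. tl_code) i)) = length (list_decode (L x))" for x
    using rec_tl_code[of "list_decode (L x)"] by (simp del: sum_of_bool_eq)
  ultimately show ?thesis by simp
qed

lemma tcomp_list_encode_Cons [tcomp_intros]:
  "tcomp f \<Longrightarrow> tcomp (\<lambda>x. list_encode (xs x)) \<Longrightarrow> tcomp (\<lambda>x. list_encode (f x # xs x))"
  unfolding list_encode_Cons_pair by (intro tcomp_intros)

lemma tcomp_list_encode_tl [tcomp_intros]:
  "tcomp (\<lambda>x. list_encode (xs x)) \<Longrightarrow> tcomp (\<lambda>x. list_encode (tl (xs x)))"
  unfolding tl_code_list_encode[symmetric] by (intro tcomp_intros)

text \<open>Codes are extended at the front, so the list is built from its end: round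
  \<open>m\<close> prepends the entry with index \<open>n x - Suc m\<close>.\<close>

lemma tcomp_list_encode_map [tcomp_intros]:
  assumes "tcomp (\<lambda>z. f (pfst z) (psnd z))" "tcomp n"
  shows "tcomp (\<lambda>x. list_encode (map (f x) [0..<n x]))"
proof -
  have "tcomp (\<lambda>z. f (pfst z) (n (pfst z) - Suc (pfst (psnd z))))"
    using tcomp_comp[OF assms(1), of "\<lambda>z. pair (pfst z) (n (pfst z) - Suc (pfst (psnd z)))"]
    by (simp add: tcomp_intros tcomp_comp[OF assms(2)])
  then have "tcomp (\<lambda>x. rec_nat 0 (\<lambda>m r. Suc (pair (f x (n x - Suc m)) r)) (n x))"
    by (intro tcomp_intros assms)
  moreover have "rec_nat 0 (\<lambda>m r. Suc (pair (f x (k - Suc m)) r)) j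
      = list_encode (map (f x) [k - j..<k])" if "j \<le> k" for x j k
    using that
  proof (induction j)
    case (Suc j)
    then have "[k - Suc j..<k] = (k - Suc j) # [k - j..<k]"
      by (subst upt_rec) (simp add: Suc_diff_Suc)
    then show ?case using Suc by (simp add: list_encode_Cons_pair)
  qed simp
  from this[of "n _" "n _"] have
    "rec_nat 0 (\<lambda>m r. Suc (pair (f x (n x - Suc m)) r)) (n x) = list_encode (map (f x) [0..<n x])" for x
    by simp
  ultimately show ?thesis by simp
qed


section \<open>Evaluation with bounded resources\<close>

text \<open>The number \<open>t\<close> bounds both the searches and the part of the oracle that may be read;
  the value \<open>0\<close> means that the bound was too small, and \<open>Suc v\<close> is the result \<open>v\<close>.\<close>

fun bev :: "prog \<Rightarrow> nat \<Rightarrow> baire \<Rightarrow> nat list \<Rightarrow> nat" where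
  "bev Zero t p xs = 1"
| "bev Succ t p xs = (if length xs = 0 then 0 else Suc (Suc (nth0 xs 0)))"
| "bev (Proj i) t p xs = (if i < length xs then Suc (nth0 xs i) else 0)"
| "bev Oracle t p xs = (if length xs = 0 \<or> t \<le> nth0 xs 0 then 0 else Suc (p (nth0 xs 0)))"
| "bev (Comp f gs) t p xs =
     (if \<exists>g\<in>set gs. bev g t p xs = 0 then 0 else bev f t p (map (\<lambda>g. bev g t p xs - 1) gs))"
| "bev (Prec f g) t p xs =
     (if length xs = 0 then 0
      else rec_nat (bev f t p (tl xs))
        (\<lambda>m r. if r = 0 then 0 else bev g t p (m # (r - 1) # tl xs)) (nth0 xs 0))"
| "bev (Mu f) t p xs =
     (let n = LEAST n. t \<le> n \<or> bev f t p (n # xs) < 2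
      in if n < t \<and> bev f t p (n # xs) = 1 then Suc n else 0)"

lemma those_eq_Some_iff: "those xs = Some ys \<longleftrightarrow> xs = map Some ys"
  by (induction xs arbitrary: ys) (auto split: option.splits simp: map_eq_Cons_conv Cons_eq_map_conv)

lemma bev_sound: "bev c t p xs = Suc v \<Longrightarrow> ev c p xs = Some v"
proof (induction c arbitrary: xs v)
  case (Comp f gs)
  have nz: "\<forall>g\<in>set gs. bev g t p xs \<noteq> 0"
    and f: "bev f t p (map (\<lambda>g. bev g t p xs - 1) gs) = Suc v"
    using Comp.prems by (auto split: if_splits)
  have "ev g p xs = Some (bev g t p xs - 1)" if "g \<in> set gs" for g
    using nz that by (intro Comp.IH(2)[OF that]) simp
  then have "those (map (\<lambda>g. ev g p xs) gs) = Some (map (\<lambda>g. bev g t p xs - 1) gs)"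
    by (simp add: those_eq_Some_iff)
  then show ?case using Comp.IH(1)[OF f] by simp
next
  case (Prec f g)
  then obtain n ys where xs: "xs = n # ys" by (cases xs) auto
  let ?r = "rec_nat (bev f t p ys) (\<lambda>m r. if r = 0 then 0 else bev g t p (m # (r - 1) # ys))"
  let ?s = "rec_nat (ev f p ys) (\<lambda>m r. Option.bind r (\<lambda>v. ev g p (m # v # ys)))"
  have "?r n = Suc v \<Longrightarrow> ?s n = Some v" for n v
  proof (induction n arbitrary: v)
    case (Suc n)
    then have "?r n \<noteq> 0" "bev g t p (n # (?r n - 1) # ys) = Suc v" by (auto split: if_splits)
    then show ?case using Suc.IH[of "?r n - 1"] Prec.IH(2) by simp
  qed (use Prec.IH(1) in simp)
  then show ?case using Prec.prems xs by (simp add: nth0_def cong: if_cong)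
next
  case (Mu f)
  \<comment> \<open>A value below 2 is either 1, the zero that is sought, or 0, an exceeded bound.
    The search stops at both, so it never passes over an unfinished evaluation.\<close>
  define n where "n = (LEAST n. t \<le> n \<or> bev f t p (n # xs) < 2)"
  have n: "n < t" "bev f t p (n # xs) = 1" "v = n"
    using Mu.prems by (auto simp: n_def Let_def split: if_splits)
  have m: "\<exists>w. ev f p (m # xs) = Some (Suc w)" if "m < n" for m
  proof -
    have "\<not> (t \<le> m \<or> bev f t p (m # xs) < 2)" using that unfolding n_def by (rule not_less_Least)
    then have "bev f t p (m # xs) = Suc (Suc (bev f t p (m # xs) - 2))" by linarith
    then show ?thesis using Mu.IH by blast
  qed
  have z: "ev f p (n # xs) = Some 0" using n Mu.IH by simp
  have "(LEAST n. ev f p (n # xs) = Some 0) = n"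
    using z m by (intro Least_equality) (force simp: not_less[symmetric])+
  then show ?case using z m n by auto
qed (auto split: if_splits list.splits simp: nth0_def hd_conv_nth)

text \<open>The form with "eventually" lets the bounds of finitely many subcomputations be combined
  directly, without a separate monotonicity argument in \<open>t\<close>.\<close>

lemma bev_complete: "ev c p xs = Some v \<Longrightarrow> \<forall>\<^sub>F t in sequentially. bev c t p xs = Suc v"
proof (induction c arbitrary: xs v)
  case Oracle
  then obtain x ys where "xs = x # ys" "v = p x" by (cases xs) auto
  then show ?case
    using eventually_gt_at_top[of x] by (auto simp: nth0_def not_le)
next
  case (Comp f gs)
  then obtain ys where ys: "map (\<lambda>g. ev g p xs) gs = map Some ys" and f: "ev f p ys = Some v"
    by (auto simp: bind_eq_Some_conv those_eq_Some_iff)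
  define h where "h = (\<lambda>g. the (ev g p xs))"
  have h: "ev g p xs = Some (h g)" if "g \<in> set gs" for g
  proof -
    have "ev g p xs \<in> set (map Some ys)" unfolding ys[symmetric] using that by simp
    then show ?thesis by (auto simp: h_def)
  qed
  have "map Some ys = map Some (map h gs)" unfolding ys[symmetric] by (simp add: h)
  then have ys_eq: "ys = map h gs" by (simp only: inj_map_eq_map[OF inj_Some])
  have "\<forall>\<^sub>F t in sequentially. \<forall>g\<in>set gs. bev g t p xs = Suc (h g)"
    using Comp.IH(2) h by (intro eventually_ball_finite) auto
  moreover have "\<forall>\<^sub>F t in sequentially. bev f t p ys = Suc v" by (rule Comp.IH(1)[OF f])
  ultimately show ?case
  proof eventually_elim
    case (elim t)
    then have "map (\<lambda>g. bev g t p xs - 1) gs = ys" by (simp add: ys_eq)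
    then show ?case using elim by simp
  qed
next
  case (Prec f g)
  then obtain n ys where xs: "xs = n # ys" by (cases xs) auto
  let ?r = "\<lambda>t. rec_nat (bev f t p ys) (\<lambda>m r. if r = 0 then 0 else bev g t p (m # (r - 1) # ys))"
  let ?s = "rec_nat (ev f p ys) (\<lambda>m r. Option.bind r (\<lambda>v. ev g p (m # v # ys)))"
  have "?s n = Some v \<Longrightarrow> \<forall>\<^sub>F t in sequentially. ?r t n = Suc v" for n v
  proof (induction n arbitrary: v)
    case (Suc n)
    then obtain w where w: "?s n = Some w" "ev g p (n # w # ys) = Some v"
      by (auto simp: bind_eq_Some_conv)
    from Suc.IH[OF w(1)] Prec.IH(2)[OF w(2)] show ?case by eventually_elim simp
  qed (use Prec.IH(1) in simp)
  then show ?case using Prec.prems xs by (simp add: nth0_def cong: if_cong)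
next
  case (Mu f)
  then have ex: "\<exists>n. ev f p (n # xs) = Some 0 \<and> (\<forall>m<n. \<exists>w. ev f p (m # xs) = Some (Suc w))"
    and v: "v = (LEAST n. ev f p (n # xs) = Some 0)"
    by (auto split: if_splits)
  then obtain n where n: "ev f p (n # xs) = Some 0"
    and m: "\<And>m. m < n \<Longrightarrow> \<exists>w. ev f p (m # xs) = Some (Suc w)" by blast
  have "v = n" unfolding v
    using n m by (intro Least_equality) (force simp: not_less[symmetric])+
  obtain w where w: "\<And>m. m < n \<Longrightarrow> ev f p (m # xs) = Some (Suc (w m))" using m by metis
  have "\<forall>\<^sub>F t in sequentially. \<forall>m\<in>{..<n}. bev f t p (m # xs) = Suc (Suc (w m))"
    using w Mu.IH by (intro eventually_ball_finite) auto
  moreover have "\<forall>\<^sub>F t in sequentially. bev f t p (n # xs) = Suc 0" by (rule Mu.IH[OF n])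
  moreover note eventually_gt_at_top[of n]
  ultimately show ?case
  proof eventually_elim
    case (elim t)
    then have "(LEAST n. t \<le> n \<or> bev f t p (n # xs) < 2) = n"
      by (intro Least_equality) (force simp: not_less[symmetric])+
    then show ?case using elim \<open>v = n\<close> by (simp add: Let_def)
  qed
qed (auto split: if_splits list.splits simp: nth0_def hd_conv_nth)

lemma bev_cong: "(\<And>i. i < t \<Longrightarrow> p i = q i) \<Longrightarrow> bev c t p xs = bev c t q xs"
proof (induction c arbitrary: xs)
  case (Comp f gs)
  then show ?case by (simp cong: bex_cong map_cong) fastforce
next
  case (Prec f g)
  then have eq: "bev f t p ys = bev f t q ys" "bev g t p ys = bev g t q ys" for ys by blast+
  show ?case unfolding bev.simps eq ..
qed auto

text \<open>The use principle: a halting run is reproduced by a bounded one, which reads the oracle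
  only below its bound.\<close>

lemma ev_finite_use:
  assumes "ev c p xs = Some v"
  shows "\<exists>N. \<forall>q. (\<forall>i<N. q i = p i) \<longrightarrow> ev c q xs = Some v"
proof -
  obtain N where "bev c N p xs = Suc v"
    using bev_complete[OF assms] by (auto simp: eventually_sequentially)
  then show ?thesis using bev_sound bev_cong[of N] by metis
qed

text \<open>Induction on \<open>c\<close>. The functions \<open>T\<close>, \<open>E\<close> and
  \<open>L\<close> are generalised because under \<open>Prec\<close> and \<open>Mu\<close> the
  subprogram receives the recursion or search variable, which is packed into their common
  parameter.\<close>

lemma tcomp_bev:
  assumes h: "tcomp (\<lambda>z. h (pfst z) (psnd z))"
  shows "tcomp T \<Longrightarrow> tcomp E \<Longrightarrow> tcomp (\<lambda>x. list_encode (L x)) \<Longrightarrow>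
    tcomp (\<lambda>x. bev c (T x) (h (E x)) (L x))"
proof (induction c arbitrary: T E L)
  case Zero
  show ?case by (simp add: tcomp_intros)
next
  case Succ
  have "tcomp (\<lambda>x. bev Succ (T x) (h (E x)) (list_decode (list_encode (L x))))"
    unfolding bev.simps by (intro tcomp_intros Succ)
  then show ?case by simp
next
  case (Proj i)
  have "tcomp (\<lambda>x. bev (Proj i) (T x) (h (E x)) (list_decode (list_encode (L x))))"
    unfolding bev.simps by (intro tcomp_intros Proj)
  then show ?case by simp
next
  case Oracle
  have "tcomp (\<lambda>x. nth0 (list_decode (list_encode (L x))) 0)"
    by (intro tcomp_intros Oracle)
  from tcomp_comp[OF h tcomp_pair[OF Oracle(2) this]]
  have "tcomp (\<lambda>x. h (E x) (nth0 (list_decode (list_encode (L x))) 0))"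
    by simp
  then have "tcomp (\<lambda>x. bev Oracle (T x) (h (E x)) (list_decode (list_encode (L x))))"
    unfolding bev.simps by (intro tcomp_intros Oracle)
  then show ?case by simp
next
  case (Comp f gs)
  have "tcomp (\<lambda>x. of_bool (\<exists>g\<in>set gs'. bev g (T x) (h (E x)) (L x) = 0))
      \<and> tcomp (\<lambda>x. list_encode (map (\<lambda>g. bev g (T x) (h (E x)) (L x) - 1) gs'))"
    if "set gs' \<subseteq> set gs" for gs' using that
  proof (induction gs')
    case (Cons g gs')
    then have "tcomp (\<lambda>x. bev g (T x) (h (E x)) (L x))" using Comp.IH(2) Comp.prems by simp
    then show ?case using Cons by (simp add: tcomp_intros del: of_bool_or_iff)
  qed (simp add: tcomp_intros)
  then show ?case unfolding bev.simps
    by (intro tcomp_intros Comp.IH(1) Comp.prems) simp_all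
next
  case (Prec f g)
  note 1 = Prec.prems[THEN tcomp_comp, OF tcomp_pfst, OF tcomp_id]
  have len: "tcomp (\<lambda>x. length (L x))" and hd: "tcomp (\<lambda>x. nth0 (L x) 0)"
    using tcomp_length[OF Prec.prems(3)] tcomp_nth0[OF Prec.prems(3) tcomp_const] by simp_all
  show ?case unfolding bev.simps
    by (intro tcomp_intros len hd Prec.IH 1 Prec.prems)
next
  case (Mu f)
  note 1 = Mu.prems[THEN tcomp_comp, OF tcomp_pfst, OF tcomp_id]
  have least: "tcomp (\<lambda>x. LEAST n. T x \<le> n \<or> bev f (T x) (h (E x)) (n # L x) < 2)"
    by (intro tcomp_Least tcomp_intros Mu.IH 1 Mu.prems)
  show ?case unfolding bev.simps Let_def
    by (intro tcomp_intros least Mu.IH 1 Mu.prems)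
qed


section \<open>Names of open subsets of a metric space\<close>

text \<open>For a dense sequence these are exactly the points having a name that begins with
  \<open>w\<close>.\<close>

definition cyl :: "(nat \<Rightarrow> 'a::metric_space) \<Rightarrow> nat list \<Rightarrow> 'a set" where
  "cyl a w = {x. \<forall>i<length w. dist (a (w ! i)) x < 1 / 2 ^ i}"

lemma open_cyl: "open (cyl a w)"
proof -
  have "cyl a w = (\<Inter>i<length w. ball (a (w ! i)) (1 / 2 ^ i))"
    by (auto simp: cyl_def)
  then show ?thesis by (simp add: open_INT)
qed

lemma mem_cyl_prefix: "metric_rep a v = Some x \<Longrightarrow> x \<in> cyl a (map v [0..<k])"
  by (simp add: cyl_def metric_rep_iff)

lemma dense_index:
  assumes "closure (range a) = UNIV" "0 < e"
  shows "\<exists>j. dist (a j) x < e"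
  using assms closure_approachable[of x "range a"] by auto

lemma ex_name_extending:
  assumes "closure (range a) = UNIV" "x \<in> cyl a w"
  obtains v where "metric_rep a v = Some x" "map v [0..<length w] = w"
proof -
  have "\<exists>j. dist (a j) x < 1 / 2 ^ i \<and> (i < length w \<longrightarrow> j = w ! i)" for i
    using assms(2) dense_index[OF assms(1), of "1 / 2 ^ i" x] by (auto simp: cyl_def)
  then obtain v where v: "\<And>i. dist (a (v i)) x < 1 / 2 ^ i \<and> (i < length w \<longrightarrow> v i = w ! i)"
    by metis
  then have "map v [0..<length w] = w" by (intro nth_equalityI) auto
  with v that show ?thesis by (auto simp: metric_rep_iff)
qed

lemma ex_name:
  assumes "closure (range a) = UNIV"
  obtains v where "metric_rep a v = Some x"
  using ex_name_extending[OF assms, of x "[]"] by (auto simp: cyl_def)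

lemma ran_metric_rep: "closure (range a) = UNIV \<Longrightarrow> ran (metric_rep a) = UNIV"
  unfolding ran_def by (auto elim: ex_name)

lemma open_rep_iff:
  assumes "ran \<delta> = UNIV"
  shows "open_rep \<delta> u = Some U \<longleftrightarrow> (\<forall>v x. \<delta> v = Some x \<longrightarrow>
    (\<exists>q. (\<forall>n. assoc_app u v n = Some (q n)) \<and> (\<exists>n. q n \<noteq> 0) = (x \<in> U)))"
proof -
  have "open_rep \<delta> u = Some U \<longleftrightarrow> fun_rep \<delta> sierpinski_rep u = Some (\<lambda>x. x \<in> U)"
    by (auto simp: open_rep_def assms)
  also have "\<dots> \<longleftrightarrow> (\<forall>v x. \<delta> v = Some x \<longrightarrow>
    (\<exists>q. (\<forall>n. assoc_app u v n = Some (q n)) \<and> (\<exists>n. q n \<noteq> 0) = (x \<in> U)))"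
    by (simp add: fun_rep_iff sierpinski_rep_def assms)
  finally show ?thesis .
qed

text \<open>The associate \<open>u\<close> announces a nonzero \<open>n\<close>-th output, hence
  membership, exactly when \<open>w\<close> has been read. Output \<open>v\<close> is stored as
  \<open>Suc v\<close>, which explains the threshold 2.\<close>

definition accepts :: "baire \<Rightarrow> nat \<Rightarrow> nat list \<Rightarrow> bool" where
  "accepts u n w \<longleftrightarrow> 2 \<le> u (pair n (list_encode w)) \<and>
     (\<forall>i<length w. u (pair n (list_encode (take i w))) = 0)"

lemma take_map_upt: "i \<le> k \<Longrightarrow> take i (map v [0..<k]) = map v [0..<i]"
  by (simp add: take_map)

lemma assoc_app_nonzero_iff:
  "(\<exists>y. assoc_app u v n = Some y \<and> y \<noteq> 0) \<longleftrightarrow> (\<exists>k. accepts u n (map v [0..<k]))"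
proof -
  define w where "w = (\<lambda>k. u (pair n (list_encode (map v [0..<k]))))"
  have app: "assoc_app u v n = (if \<exists>k. w k \<noteq> 0 then Some (w (LEAST k. w k \<noteq> 0) - 1) else None)"
    by (simp add: assoc_app_def w_def pair_def Let_def)
  have acc: "accepts u n (map v [0..<k]) \<longleftrightarrow> 2 \<le> w k \<and> (\<forall>i<k. w i = 0)" for k
    by (auto simp: accepts_def w_def take_map_upt)
  show ?thesis
  proof
    assume "\<exists>y. assoc_app u v n = Some y \<and> y \<noteq> 0"
    then have "2 \<le> w (LEAST k. w k \<noteq> 0)" by (auto simp: app split: if_splits)
    then show "\<exists>k. accepts u n (map v [0..<k])"
      unfolding acc using not_less_Least by blast
  next
    assume "\<exists>k. accepts u n (map v [0..<k])"
    then obtain k where k: "2 \<le> w k" "\<forall>i<k. w i = 0" unfolding acc by blast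
    then have "(LEAST k. w k \<noteq> 0) = k"
      by (intro Least_equality) (auto simp: not_less[symmetric])
    then show "\<exists>y. assoc_app u v n = Some y \<and> y \<noteq> 0"
      using k(1) by (auto simp: app intro!: exI[of _ k])
  qed
qed

lemma accepts_prefix_iff:
  assumes "ran \<delta> = UNIV" "open_rep \<delta> u = Some U" "\<delta> v = Some x"
  shows "x \<in> U \<longleftrightarrow> (\<exists>n k. accepts u n (map v [0..<k]))"
proof -
  obtain q where "\<And>n. assoc_app u v n = Some (q n)" "(\<exists>n. q n \<noteq> 0) = (x \<in> U)"
    using assms(2,3) unfolding open_rep_iff[OF assms(1)] by blast
  then show ?thesis unfolding assoc_app_nonzero_iff[symmetric] by auto
qed

text \<open>Acceptance depends on a finite prefix of a name, so it covers the whole cylinder of that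
  prefix.\<close>

lemma open_of_open_rep:
  assumes dense: "closure (range a) = UNIV" and U: "open_rep (metric_rep a) u = Some U"
  shows "open U"
proof (subst open_subopen, intro ballI)
  fix x assume "x \<in> U"
  obtain v where v: "metric_rep a v = Some x" using ex_name[OF dense] .
  from accepts_prefix_iff[OF ran_metric_rep[OF dense] U v] \<open>x \<in> U\<close>
  obtain n k where acc: "accepts u n (map v [0..<k])" by blast
  have "cyl a (map v [0..<k]) \<subseteq> U"
  proof
    fix y assume "y \<in> cyl a (map v [0..<k])"
    then obtain v' where v': "metric_rep a v' = Some y" "map v' [0..<k] = map v [0..<k]"
      by (rule ex_name_extending[OF dense]) simp
    with acc accepts_prefix_iff[OF ran_metric_rep[OF dense] U v'(1)] show "y \<in> U" by metis
  qed
  then show "\<exists>T. open T \<and> x \<in> T \<and> T \<subseteq> U"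
    using open_cyl mem_cyl_prefix[OF v] by blast
qed

text \<open>An associate that decides about the \<open>n\<close>-th output after exactly \<open>n + s\<close> entries of the
  argument have been read.\<close>

definition wait_assoc :: "nat \<Rightarrow> (nat list \<Rightarrow> bool) \<Rightarrow> baire" where
  "wait_assoc s Q z =
     (if length (list_decode (psnd z)) < pfst z + s then 0
      else if Q (list_decode (psnd z)) then 2 else 1)"

lemma assoc_app_wait_assoc:
  "assoc_app (wait_assoc s Q) v n = Some (if Q (map v [0..<n + s]) then 1 else 0)"
proof -
  define w where "w = (\<lambda>k. wait_assoc s Q (pair n (list_encode (map v [0..<k]))))"
  have w: "w k = (if k < n + s then 0 else if Q (map v [0..<k]) then 2 else 1)" for k
    by (simp add: w_def wait_assoc_def)
  have "(LEAST k. w k \<noteq> 0) = n + s"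
    by (intro Least_equality) (auto simp: w split: if_splits)
  moreover have "w (n + s) \<noteq> 0" by (simp add: w)
  moreover have "assoc_app (wait_assoc s Q) v n
      = (if \<exists>k. w k \<noteq> 0 then Some (w (LEAST k. w k \<noteq> 0) - 1) else None)"
    by (simp add: assoc_app_def w_def pair_def Let_def)
  ultimately have "assoc_app (wait_assoc s Q) v n = Some (w (n + s) - 1)" by auto
  then show ?thesis by (simp add: w)
qed

lemma open_rep_wait_assoc:
  assumes "ran \<delta> = UNIV"
    and "\<And>v x. \<delta> v = Some x \<Longrightarrow> (\<exists>n. Q (map v [0..<n + s])) = (x \<in> U)"
  shows "open_rep \<delta> (wait_assoc s Q) = Some U"
  unfolding open_rep_iff[OF assms(1)] assoc_app_wait_assoc using assms(2)
  by (intro allI impI exI[of _ "\<lambda>n. if Q (map _ [0..<n + s]) then 1 else 0"]) auto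

lemma ex_two_div_power_less: "0 < e \<Longrightarrow> \<exists>n. 2 / 2 ^ n < (e :: real)"
  using real_arch_pow_inv[of "e / 2" "1 / 2"] by (auto simp: field_simps)

text \<open>These names need not be computable. They show that every open set has a name, and they
  provide names of different sets that agree on small codes; the delay \<open>s\<close> guarantees
  that a prefix is long enough before it is judged.\<close>

lemma open_rep_cyl_subset:
  assumes dense: "closure (range a) = UNIV" and "open V"
  shows "open_rep (metric_rep a) (wait_assoc s (\<lambda>w. cyl a w \<subseteq> V)) = Some V"
proof (rule open_rep_wait_assoc[OF ran_metric_rep[OF dense]])
  fix v x assume v: "metric_rep a v = Some x"
  show "(\<exists>n. cyl a (map v [0..<n + s]) \<subseteq> V) = (x \<in> V)"
  proof
    assume "x \<in> V"
    then obtain e where e: "0 < e" "ball x e \<subseteq> V"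
      using \<open>open V\<close> open_contains_ball by blast
    obtain n where n: "2 / 2 ^ n < e" using ex_two_div_power_less[OF e(1)] ..
    have "y \<in> ball x e" if "y \<in> cyl a (map v [0..<Suc n + s])" for y
    proof -
      have "dist (a (v n)) y < 1 / 2 ^ n" using that by (auto simp: cyl_def simp del: upt_Suc)
      moreover have "dist (a (v n)) x < 1 / 2 ^ n" using v by (simp add: metric_rep_iff)
      ultimately show ?thesis
        using n dist_triangle3[of x y "a (v n)"] by simp
    qed
    then show "\<exists>n. cyl a (map v [0..<n + s]) \<subseteq> V" using e(2) by blast
  qed (use mem_cyl_prefix[OF v] in blast)
qed

lemma ran_open_rep:
  assumes "closure (range a) = UNIV"
  shows "ran (open_rep (metric_rep a)) = {U. open U}"
  using open_of_open_rep[OF assms] open_rep_cyl_subset[OF assms, of _ 0] by (auto simp: ran_def)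

section \<open>Compactness and continuity from computability\<close>

text \<open>The program semi-deciding \<open>U = X\<close> accepts a name of \<open>X\<close> after reading finitely many of its
  entries. These mention only finitely many points of the dense sequence, and are also part of
  a name of the union of the balls around these points.\<close>

lemma compact_of_computably_compact:
  fixes a :: "nat \<Rightarrow> 'a::complete_space"
  assumes dense: "closure (range a) = UNIV" and comp: "computably_compact (metric_rep a)"
  shows "compact (UNIV :: 'a set)"
proof -
  have "\<exists>k. finite k \<and> (UNIV :: 'a set) \<subseteq> (\<Union>x\<in>k. ball x e)" if "0 < e" for e
  proof -
    obtain K where "2 / 2 ^ K < e" using ex_two_div_power_less[OF \<open>0 < e\<close>] by blast
    then have K: "1 / 2 ^ K < e" by (smt (verit) divide_right_mono zero_le_power)
    obtain c where c: "\<And>p U. open_rep (metric_rep a) p = Some U \<Longrightarrow>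
        \<exists>q. (\<forall>n. ev c p [n] = Some (q n)) \<and> (\<exists>n. q n \<noteq> 0) = (U = UNIV)"
      using comp unfolding computably_compact_def computable_map_def sierpinski_rep_def
        ran_metric_rep[OF dense] by auto
    \<comment> \<open>The delay \<open>Suc K\<close> guarantees that the entry with index
      \<open>K\<close>, which fixes the point up to \<open>1 / 2 ^ K\<close>, is present whenever an
      answer is given.\<close>
    let ?u = "\<lambda>V. wait_assoc (Suc K) (\<lambda>w. cyl a w \<subseteq> V)"
    have name: "open_rep (metric_rep a) (?u V) = Some V" if "open V" for V
      by (rule open_rep_cyl_subset[OF dense that])
    from c[OF name[OF open_UNIV]] obtain n y where "ev c (?u UNIV) [n] = Some y" "y \<noteq> 0" by auto
    from ev_finite_use[OF this(1)] obtain N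
      where N: "\<And>q. (\<forall>i<N. q i = ?u UNIV i) \<Longrightarrow> ev c q [n] = Some y" by blast
    define V where "V = (\<Union>i<N. ball (a i) (1 / 2 ^ K))"
    \<comment> \<open>Codes dominate the entries of their lists. So a prefix with code argument
      below \<open>N\<close> has its entry \<open>K\<close> below \<open>N\<close>, its cylinder
      lies in one of the balls of \<open>V\<close>, and both names accept it.\<close>
    have "?u V z = ?u UNIV z" if "z < N" for z
    proof (cases "length (list_decode (psnd z)) < pfst z + Suc K")
      case False
      define w where "w = list_decode (psnd z)"
      have len: "K < length w" using False by (simp add: w_def)
      have "w ! K < N"
        using nth_less_list_encode[OF len] le_pair(2)[of "psnd z" "pfst z"] that by (simp add: w_def)
      then have "cyl a w \<subseteq> V" using len by (auto simp: cyl_def V_def)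
      then show ?thesis by (simp add: wait_assoc_def w_def)
    qed (simp add: wait_assoc_def)
    then have "ev c (?u V) [n] = Some y" by (intro N) simp
    moreover have "open V" by (auto simp: V_def)
    ultimately have "V = UNIV" using c[OF name] \<open>y \<noteq> 0\<close> by (metis option.inject)
    moreover have "V \<subseteq> (\<Union>x\<in>a ` {..<N}. ball x e)" using K by (force simp: V_def)
    ultimately show ?thesis by blast
  qed
  then show ?thesis unfolding compact_eq_totally_bounded using complete_UNIV by blast
qed

definition interleave :: "baire \<Rightarrow> baire \<Rightarrow> baire" where
  "interleave p q i = (if even i then p (i div 2) else q (i div 2))"

lemma prod_rep_interleave:
  "\<delta> p = Some x \<Longrightarrow> \<delta>' q = Some y \<Longrightarrow> prod_rep \<delta> \<delta>' (interleave p q) = Some (x, y)"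
  by (simp add: prod_rep_def interleave_def)

text \<open>The \<open>n\<close>-th output entry fixes the value up to \<open>1 / 2 ^ n\<close> and
  depends on finitely many oracle entries. Every point of the product of the corresponding cylinders
  has a name sharing these entries, hence the same output entry.\<close>

lemma continuous_of_computable:
  fixes a :: "nat \<Rightarrow> 'a::metric_space"
  assumes dense: "closure (range a) = UNIV"
    and f: "computable_map (prod_rep (metric_rep a) (metric_rep a)) (metric_rep a) f"
  shows "continuous_on UNIV f"
proof -
  obtain c where c: "\<And>p x. prod_rep (metric_rep a) (metric_rep a) p = Some x \<Longrightarrow>
      \<exists>q. (\<forall>n. ev c p [n] = Some (q n)) \<and> metric_rep a q = Some (f x)"
    using f unfolding computable_map_def by blast
  have "(f \<longlongrightarrow> f (x, y)) (at (x, y))" for x y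
  proof (rule tendstoI)
    fix e :: real assume "0 < e"
    then obtain n where n: "2 / 2 ^ n < e" using ex_two_div_power_less by blast
    obtain p q where p: "metric_rep a p = Some x" and q: "metric_rep a q = Some y"
      using ex_name[OF dense] by metis
    from c[OF prod_rep_interleave[of "metric_rep a" _ _ "metric_rep a", OF p q]]
    obtain r where r: "ev c (interleave p q) [n] = Some (r n)" "metric_rep a r = Some (f (x, y))"
      by blast
    from ev_finite_use[OF r(1)] obtain N
      where N: "\<And>o'. (\<forall>i<N. o' i = interleave p q i) \<Longrightarrow> ev c o' [n] = Some (r n)" by blast
    let ?S = "cyl a (map p [0..<N]) \<times> cyl a (map q [0..<N])"
    have "dist (f z) (f (x, y)) < e" if zS: "z \<in> ?S" for z
    proof -
      obtain x' y' where z: "z = (x', y')" "x' \<in> cyl a (map p [0..<N])" "y' \<in> cyl a (map q [0..<N])"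
        using zS by blast
      obtain p' where p': "metric_rep a p' = Some x'" "map p' [0..<N] = map p [0..<N]"
        by (rule ex_name_extending[OF dense z(2)]) simp
      obtain q' where q': "metric_rep a q' = Some y'" "map q' [0..<N] = map q [0..<N]"
        by (rule ex_name_extending[OF dense z(3)]) simp
      from c[OF prod_rep_interleave[of "metric_rep a" _ _ "metric_rep a", OF p'(1) q'(1)]]
      obtain r' where r': "ev c (interleave p' q') [n] = Some (r' n)" "metric_rep a r' = Some (f z)"
        using z by blast
      have "r' n = r n" using N[of "interleave p' q'"] r'(1) p'(2) q'(2)
        by (auto simp: interleave_def)
      then show ?thesis
        using r(2) r'(2) n dist_triangle3[of "f z" "f (x, y)" "a (r n)"]
        by (fastforce simp: metric_rep_iff dest: spec[of _ n])
    qed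
    then show "\<forall>\<^sub>F z in at (x, y). dist (f z) (f (x, y)) < e"
      unfolding eventually_at_topological
      using mem_cyl_prefix[OF p] mem_cyl_prefix[OF q]
      by (intro exI[of _ ?S]) (auto intro!: open_Times open_cyl)
  qed
  then show ?thesis by (auto simp: continuous_on_def)
qed


section \<open>Haar measure by counting translates\<close>

lemma borel_measurable_of_continuous:
  fixes f :: "'a::topological_space \<Rightarrow> 'b::topological_space"
  assumes "sets M = sets borel" "continuous_on UNIV f"
  shows "f \<in> borel_measurable M"
  using borel_measurable_continuous_onI[OF assms(2)] measurable_cong_sets[OF assms(1) refl] by blast

text \<open>Invariance is given for images; the preimage under translation by \<open>g\<close> is
  the image under translation by \<open>iv g\<close>.\<close>

lemma distr_haar:
  fixes mul :: "'a::topological_space \<Rightarrow> 'a \<Rightarrow> 'a"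
  assumes haar: "haar_prob_measure mul \<mu>" and grp: "group mul e iv"
    and cont: "\<And>g. continuous_on UNIV (mul g)"
  shows "distr \<mu> \<mu> (mul g) = \<mu>"
proof (rule measure_eqI)
  interpret group mul e iv by fact
  have sets: "sets \<mu> = sets borel" using haar by (simp add: haar_prob_measure_def)
  have space: "space \<mu> = UNIV" using sets_eq_imp_space_eq[OF sets] by simp
  have meas: "mul g \<in> measurable \<mu> \<mu>" for g
    using borel_measurable_continuous_onI[OF cont[of g]] measurable_cong_sets[OF sets sets] by blast
  fix A assume "A \<in> sets (distr \<mu> \<mu> (mul g))"
  then have A: "A \<in> sets \<mu>" by simp
  have "mul g -` A = mul (iv g) ` A"
  proof
    show "mul g -` A \<subseteq> mul (iv g) ` A"
    proof
      fix x assume "x \<in> mul g -` A"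
      then have "x = mul (iv g) (mul g x)" by (simp add: assoc[symmetric] group_left_neutral)
      then show "x \<in> mul (iv g) ` A" using \<open>x \<in> mul g -` A\<close> by blast
    qed
    show "mul (iv g) ` A \<subseteq> mul g -` A" by (auto simp: assoc[symmetric] group_left_neutral)
  qed
  then show "emeasure (distr \<mu> \<mu> (mul g)) A = emeasure \<mu> A"
    using A haar sets by (simp add: emeasure_distr[OF meas] space haar_prob_measure_def)
qed simp

lemma integral_translate:
  fixes mul :: "'a::topological_space \<Rightarrow> 'a \<Rightarrow> 'a" and f :: "'a \<Rightarrow> real"
  assumes haar: "haar_prob_measure mul \<mu>" and grp: "group mul e iv"
    and cont: "\<And>g. continuous_on UNIV (mul g)" and f: "f \<in> borel_measurable \<mu>"
  shows "(\<integral>x. f (mul g x) \<partial>\<mu>) = (\<integral>x. f x \<partial>\<mu>)"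
proof -
  have sets: "sets \<mu> = sets borel" using haar by (simp add: haar_prob_measure_def)
  have meas: "mul g \<in> measurable \<mu> \<mu>"
    using borel_measurable_continuous_onI[OF cont[of g]] measurable_cong_sets[OF sets sets] by blast
  have "(\<integral>x. f x \<partial>\<mu>) = (\<integral>x. f x \<partial>distr \<mu> \<mu> (mul g))"
    by (simp add: distr_haar[OF haar grp cont])
  then show ?thesis by (simp add: integral_distr[OF meas f])
qed

lemma haar_measure_ge:
  fixes mul :: "'a::topological_space \<Rightarrow> 'a \<Rightarrow> 'a" and m n :: nat
  assumes haar: "haar_prob_measure mul \<mu>" and grp: "group mul e iv"
    and cont: "\<And>g. continuous_on UNIV (mul g)" and U: "open U"
    and m: "\<And>x. m \<le> (\<Sum>i<n. of_bool (mul (g i) x \<in> U))"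
  shows "real m \<le> n * measure \<mu> U"
proof -
  interpret prob_space \<mu> using haar by (simp add: haar_prob_measure_def)
  have sets: "sets \<mu> = sets borel" using haar by (simp add: haar_prob_measure_def)
  have space: "space \<mu> = UNIV" using sets_eq_imp_space_eq[OF sets] by simp
  have UM: "U \<in> sets \<mu>" using U by (simp add: sets)
  let ?I = "indicator U :: 'a \<Rightarrow> real"
  have I: "?I \<in> borel_measurable \<mu>" using UM by simp
  have int: "integrable \<mu> (\<lambda>x. ?I (mul h x))" for h
  proof (rule integrable_const_bound[of _ 1])
    have "mul h \<in> measurable \<mu> \<mu>"
      using borel_measurable_continuous_onI[OF cont[of h]] measurable_cong_sets[OF sets sets] by blast
    then show "(\<lambda>x. ?I (mul h x)) \<in> borel_measurable \<mu>" using I by measurable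
  qed (auto simp: indicator_def)
  have "real m = (\<integral>x. real m \<partial>\<mu>)" by (simp add: prob_space)
  also have "\<dots> \<le> (\<integral>x. (\<Sum>i<n. ?I (mul (g i) x)) \<partial>\<mu>)"
  proof (intro integral_mono)
    fix x
    have "real m \<le> real (\<Sum>i<n. of_bool (mul (g i) x \<in> U))" using m[of x] by (simp only: of_nat_le_iff)
    also have "\<dots> = (\<Sum>i<n. ?I (mul (g i) x))"
      unfolding of_nat_sum by (intro sum.cong) (auto simp: indicator_def)
    finally show "real m \<le> (\<Sum>i<n. ?I (mul (g i) x))" .
  qed (use int in auto)
  also have "\<dots> = (\<Sum>i<n. \<integral>x. ?I (mul (g i) x) \<partial>\<mu>)"
    by (intro Bochner_Integration.integral_sum int)
  also have "\<dots> = (\<Sum>i<n. measure \<mu> U)"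
    using UM by (simp add: integral_translate[OF haar grp cont I] space)
  finally show ?thesis by simp
qed

text \<open>The shear \<open>(x, y)\<close> to \<open>(x, mul x y)\<close> is a continuous bijection
  of a compact Hausdorff space, so its inverse is continuous; evaluating that inverse at
  \<open>(x, e)\<close> yields \<open>iv x\<close>.\<close>

lemma continuous_inverse:
  fixes mul :: "'a::metric_space \<Rightarrow> 'a \<Rightarrow> 'a"
  assumes comp: "compact (UNIV :: 'a set)" and grp: "group mul e iv"
    and cont: "continuous_on UNIV (\<lambda>(x, y). mul x y)"
  shows "continuous_on UNIV iv"
proof -
  interpret group mul e iv by fact
  let ?f = "\<lambda>(x, y). (x, mul x y)" and ?g = "\<lambda>(x, z). (x, mul (iv x) z)"
  have fg: "?f (?g z) = z" and gf: "?g (?f z) = z" for z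
    by (auto simp: split_beta assoc[symmetric] group_left_neutral)
  have "continuous_on (UNIV \<times> UNIV) ?f"
    using cont by (auto simp: split_beta intro!: continuous_intros)
  from continuous_on_inv[OF this compact_Times[OF comp comp], of ?g] gf
  have "continuous_on (range ?f) ?g" by simp
  moreover have "range ?f = UNIV" using surjI[of ?f ?g, OF fg] .
  ultimately have "continuous_on UNIV ?g" by simp
  from continuous_on_compose2[OF this, of UNIV "\<lambda>x. (x, e)"]
  have "continuous_on UNIV (\<lambda>x. (x, mul (iv x) e))" by (simp add: continuous_on_Pair)
  from continuous_on_snd[OF this] show ?thesis by simp
qed

text \<open>\<open>U\<close> is exhausted by the closed sets of points at distance at least
  \<open>1 / Suc n\<close> from the complement; a truncated multiple of that distance is 1 on such a
  set.\<close>

lemma ex_continuous_below_indicator: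
  fixes U :: "'a::metric_space set"
  assumes "prob_space \<mu>" "sets \<mu> = sets borel" "open U" "r < measure \<mu> U"
  obtains f :: "'a \<Rightarrow> real"
  where "continuous_on UNIV f" "\<And>x. 0 \<le> f x" "\<And>x. f x \<le> of_bool (x \<in> U)" "r < (\<integral>x. f x \<partial>\<mu>)"
proof (cases "U = UNIV")
  \<comment> \<open>The distance to the empty complement is 0 by convention, so the whole space is
    treated separately.\<close>
  case True
  interpret prob_space \<mu> by fact
  have "space \<mu> = UNIV" using sets_eq_imp_space_eq[OF assms(2)] by simp
  then show ?thesis using that[of "\<lambda>_. 1"] True assms(4) prob_space by simp
next
  case False
  interpret prob_space \<mu> by fact
  define A where "A = (\<lambda>n. {x. 1 / real (Suc n) \<le> infdist x (- U)})"
  have closed: "closed (A n)" for n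
    unfolding A_def by (intro closed_Collect_le continuous_intros)
  have AM: "A n \<in> sets \<mu>" for n using closed by (simp add: assms(2))
  have "incseq A"
  proof (rule incseq_SucI)
    fix n
    have "1 / real (Suc (Suc n)) \<le> 1 / real (Suc n)" by (simp add: field_simps)
    then show "A n \<subseteq> A (Suc n)" by (auto simp: A_def simp del: of_nat_Suc)
  qed
  then have "(\<lambda>n. measure \<mu> (A n)) \<longlonglongrightarrow> measure \<mu> (\<Union>n. A n)"
    using AM by (intro finite_Lim_measure_incseq) auto
  moreover have "(\<Union>n. A n) = U"
  proof (intro set_eqI iffI)
    fix x assume "x \<in> (\<Union>n. A n)"
    then obtain n where n: "1 / real (Suc n) \<le> infdist x (- U)" by (auto simp: A_def)
    have "0 < 1 / real (Suc n)" by simp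
    then have "infdist x (- U) \<noteq> 0" using n by linarith
    then show "x \<in> U" using infdist_zero[of x "- U"] by blast
  next
    fix x assume "x \<in> U"
    then have "infdist x (- U) \<noteq> 0"
      using in_closed_iff_infdist_zero[of "- U" x] assms(3) False by auto
    then have "0 < infdist x (- U)" using infdist_nonneg[of x "- U"] by linarith
    from nat_approx_posE[OF this] obtain n where "1 / real (Suc n) < infdist x (- U)" by blast
    then have "x \<in> A n" by (simp add: A_def less_imp_le del: of_nat_Suc)
    then show "x \<in> (\<Union>n. A n)" by blast
  qed
  ultimately have "\<forall>\<^sub>F n in sequentially. r < measure \<mu> (A n)"
    using assms(4) by (intro order_tendstoD(1)) auto
  then obtain n where n: "r < measure \<mu> (A n)" by (auto simp: eventually_sequentially)
  define f where "f = (\<lambda>x. min 1 (real (Suc n) * infdist x (- U)))"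
  have cont: "continuous_on UNIV f" unfolding f_def by (intro continuous_intros)
  have f: "0 \<le> f x" "f x \<le> of_bool (x \<in> U)" for x
    using infdist_zero[of x "- U"] by (auto simp: f_def infdist_nonneg)
  have int: "integrable \<mu> f"
    using f borel_measurable_of_continuous[OF assms(2) cont]
    by (intro integrable_const_bound[of _ 1]) (auto simp: f_def infdist_nonneg)
  have "measure \<mu> (A n) = (\<integral>x. indicator (A n) x \<partial>\<mu>)" using AM by simp
  also have "\<dots> \<le> (\<integral>x. f x \<partial>\<mu>)"
  proof (intro integral_mono int)
    fix x
    have "1 \<le> real (Suc n) * infdist x (- U)" if "x \<in> A n"
      using that by (simp add: A_def field_simps)
    then show "indicator (A n) x \<le> f x" using f(1)[of x] by (auto simp: indicator_def f_def)
  qed (use AM in \<open>auto simp: emeasure_eq_measure\<close>)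
  finally show ?thesis using that[OF cont f] n by simp
qed

lemma sum_nth_concat_replicate:
  fixes G n :: "nat \<Rightarrow> nat"
  defines "xs \<equiv> \<lambda>M. concat (map (\<lambda>i. replicate (n i) i) [0..<M])"
  shows "(\<Sum>j<length (xs M). G (xs M ! j)) = (\<Sum>i<M. n i * G i)"
proof -
  have "sum_list (map G (xs M)) = (\<Sum>i<M. n i * G i)"
    unfolding xs_def by (induction M) (simp_all add: sum_list_replicate)
  then show ?thesis by (simp add: sum_list_sum_nth atLeast0LessThan)
qed

text \<open>The weights are the measures of the pieces of a fine partition of the group, on whose
  \<open>i\<close>-th piece the inverse \<open>h\<^sup>-\<^sup>1\<close> is close to \<open>a i\<close>. The weighted sum is uniformly close to
  \<open>\<integral> f (h\<^sup>-\<^sup>1 x) d\<mu>(h)\<close>, which does not depend on \<open>x\<close> by invariance, and its average over \<open>x\<close>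
  is exactly \<open>\<integral> f d\<mu>\<close>.\<close>

lemma ex_weights:
  fixes mul :: "'a::metric_space \<Rightarrow> 'a \<Rightarrow> 'a" and f :: "'a \<Rightarrow> real" and a :: "nat \<Rightarrow> 'a"
  assumes haar: "haar_prob_measure mul \<mu>" and grp: "group mul e iv"
    and comp: "compact (UNIV :: 'a set)" and cont: "continuous_on UNIV (\<lambda>(x, y). mul x y)"
    and dense: "closure (range a) = UNIV" and f: "continuous_on UNIV f" and "0 < \<epsilon>"
  obtains p M where "\<And>i. 0 \<le> p i" "(\<Sum>i<M::nat. p i) = (1::real)"
    "\<And>x. (\<integral>x. f x \<partial>\<mu>) - 2 * \<epsilon> \<le> (\<Sum>i<M. p i * f (mul (a i) x))"
proof -
  interpret group mul e iv by fact
  interpret prob_space \<mu> using haar by (simp add: haar_prob_measure_def)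
  have sets: "sets \<mu> = sets borel" using haar by (simp add: haar_prob_measure_def)
  have space: "space \<mu> = UNIV" using sets_eq_imp_space_eq[OF sets] by simp
  have contiv: "continuous_on UNIV iv" by (rule continuous_inverse[OF comp grp cont])
  have cont2: "continuous_on UNIV (\<lambda>x. mul (s x) (t x))"
    if "continuous_on UNIV s" "continuous_on UNIV t" for s t :: "'a \<Rightarrow> 'a"
    using continuous_on_compose2[OF cont continuous_on_Pair[OF that]] by simp
  have contl: "continuous_on UNIV (mul g)" for g
    by (rule cont2) (auto intro: continuous_intros)
  have contf: "continuous_on UNIV (\<lambda>x. f (t x))" if "continuous_on UNIV t" for t :: "'a \<Rightarrow> 'a"
    using continuous_on_compose2[OF f that] by simp
  have int: "integrable \<mu> g" if g: "continuous_on UNIV g" for g :: "'a \<Rightarrow> real"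
  proof -
    obtain B where "\<And>x. norm (g x) \<le> B"
      using compact_imp_bounded[OF compact_continuous_image[OF g comp]] by (auto simp: bounded_iff)
    then show ?thesis
      using borel_measurable_of_continuous[OF sets g] by (intro integrable_const_bound[of _ B]) auto
  qed
  \<comment> \<open>Uniformity on the product yields one \<open>\<delta>\<close> that serves all
    \<open>x\<close> at once.\<close>
  have "uniformly_continuous_on (UNIV \<times> UNIV) (\<lambda>z. f (mul (fst z) (snd z)))"
    using continuous_on_compose2[OF f cont] comp
    by (intro compact_uniformly_continuous compact_Times) (auto simp: split_beta)
  then obtain \<delta> where "0 < \<delta>" and \<delta>: "\<And>z z'. dist z' z < \<delta> \<Longrightarrow>
      dist (f (mul (fst z') (snd z'))) (f (mul (fst z) (snd z))) < \<epsilon>"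
    using \<open>0 < \<epsilon>\<close> unfolding uniformly_continuous_on_def by (metis UNIV_I UNIV_Times_UNIV)
  have close: "\<bar>f (mul g x) - f (mul h x)\<bar> < \<epsilon>" if "dist g h < \<delta>" for g h x
    using \<delta>[of "(g, x)" "(h, x)"] that by (simp add: dist_real_def dist_Pair_Pair)
  define A where "A = (\<lambda>i. {h. dist (a i) (iv h) < \<delta>})"
  have openA: "open (A i)" for i
    unfolding A_def by (intro open_Collect_less continuous_intros contiv)
  have "UNIV \<subseteq> (\<Union>i. A i)"
  proof
    fix h :: 'a
    show "h \<in> (\<Union>i. A i)"
      using dense \<open>0 < \<delta>\<close> closure_approachable[of "iv h" "range a"] by (auto simp: A_def)
  qed
  then obtain C where "finite C" "UNIV \<subseteq> (\<Union>i\<in>C. A i)"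
    by (rule compactE_image[OF comp openA])
  then obtain M where "C \<subseteq> {..<M}" using finite_nat_bounded by blast
  then have M: "\<exists>i<M. h \<in> A i" for h using \<open>UNIV \<subseteq> (\<Union>i\<in>C. A i)\<close> by blast
  define k where "k = (\<lambda>h. LEAST i. h \<in> A i)"
  have k: "h \<in> A (k h)" "k h < M" for h
    using M[of h] unfolding k_def by (auto intro: LeastI le_less_trans[OF Least_le])
  define E where "E = (\<lambda>i. {h. k h = i})"
  have "E i = A i - (\<Union>j<i. A j)" for i
  proof (intro set_eqI iffI)
    fix h assume "h \<in> E i"
    then have "k h = i" by (simp add: E_def)
    then show "h \<in> A i - (\<Union>j<i. A j)" using k(1)[of h] not_less_Least unfolding k_def by blast
  next
    fix h assume h: "h \<in> A i - (\<Union>j<i. A j)"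
    then have "k h \<le> i" unfolding k_def by (intro Least_le) simp
    moreover have "\<not> k h < i" using h k(1)[of h] by blast
    ultimately show "h \<in> E i" by (simp add: E_def)
  qed
  then have EM: "E i \<in> sets \<mu>" for i using openA by (auto simp: sets)
  have sumE: "(\<Sum>i<M. indicator (E i) h * c i) = (c (k h) :: real)" for h c
  proof -
    have "(\<Sum>i<M. indicator (E i) h * c i) = (\<Sum>i<M. if k h = i then c i else 0)"
      by (intro sum.cong) (auto simp: indicator_def E_def)
    then show ?thesis using k(2) by simp
  qed
  define p where "p = (\<lambda>i. measure \<mu> (E i))"
  define \<phi> where "\<phi> = (\<lambda>x. \<Sum>i<M. p i * f (mul (a i) x))"
  have intE: "integrable \<mu> (\<lambda>h. \<Sum>i<M. indicator (E i) h * c i)" for c :: "nat \<Rightarrow> real"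
    using EM by (intro Bochner_Integration.integrable_sum) (auto simp: emeasure_eq_measure)
  have integralE: "(\<integral>h. (\<Sum>i<M. indicator (E i) h * c i) \<partial>\<mu>) = (\<Sum>i<M. p i * c i)"
    for c :: "nat \<Rightarrow> real"
    using EM by (subst Bochner_Integration.integral_sum)
      (auto simp: emeasure_eq_measure p_def)
  have p1: "(\<Sum>i<M. p i) = 1"
    using integralE[of "\<lambda>_. 1"] prob_space by (simp add: sumE[of _ "\<lambda>_. 1", simplified] space)
  define C where "C = (\<integral>h. f (iv h) \<partial>\<mu>)"
  have C: "(\<integral>h. f (mul (iv h) x) \<partial>\<mu>) = C" for x
  proof -
    have meas: "(\<lambda>h. f (mul (iv h) x)) \<in> borel_measurable \<mu>"
      by (intro borel_measurable_of_continuous[OF sets] contf cont2 contiv continuous_on_const)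
    have "mul (iv (mul x h)) x = iv h" for h
      by (simp add: inverse_distrib_swap assoc)
    then show ?thesis using integral_translate[OF haar grp contl meas, of x] by (simp add: C_def)
  qed
  have close_k: "\<bar>f (mul (a (k h)) x) - f (mul (iv h) x)\<bar> < \<epsilon>" for h x
    using k(1)[of h] by (intro close) (simp add: A_def)
  have int1: "integrable \<mu> (\<lambda>h. f (mul (iv h) x))" for x
    by (intro int contf cont2 contiv continuous_on_const)
  \<comment> \<open>The upper bound is averaged over \<open>x\<close> and the lower bound is used
    pointwise; each costs one \<open>\<epsilon>\<close>, which gives the loss
    \<open>2 * \<epsilon>\<close>.\<close>
  have upper: "\<phi> x \<le> C + \<epsilon>" and lower: "C - \<epsilon> \<le> \<phi> x" for x
  proof -
    have \<phi>: "\<phi> x = (\<integral>h. f (mul (a (k h)) x) \<partial>\<mu>)"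
      unfolding \<phi>_def integralE[symmetric] sumE ..
    have int2: "integrable \<mu> (\<lambda>h. f (mul (a (k h)) x))"
      using intE[of "\<lambda>i. f (mul (a i) x)"] unfolding sumE .
    have "\<phi> x \<le> (\<integral>h. f (mul (iv h) x) + \<epsilon> \<partial>\<mu>)"
      unfolding \<phi> by (intro integral_mono int2 Bochner_Integration.integrable_add int1)
        (use close_k[of _ x] in \<open>auto simp: abs_less_iff intro: less_imp_le\<close>, smt (verit) close_k)
    also have "\<dots> = C + \<epsilon>" using C prob_space by (simp add: int1 space)
    finally show "\<phi> x \<le> C + \<epsilon>" .
    have "(\<integral>h. f (mul (iv h) x) - \<epsilon> \<partial>\<mu>) \<le> \<phi> x"
      unfolding \<phi> by (intro integral_mono int2 Bochner_Integration.integrable_diff int1)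
        (use close_k[of _ x] in \<open>auto simp: abs_less_iff intro: less_imp_le\<close>, smt (verit) close_k)
    moreover have "(\<integral>h. f (mul (iv h) x) - \<epsilon> \<partial>\<mu>) = C - \<epsilon>" using C prob_space by (simp add: int1 space)
    ultimately show "C - \<epsilon> \<le> \<phi> x" by simp
  qed
  have intf: "integrable \<mu> (\<lambda>x. f (mul g x))" for g by (intro int contf contl)
  have "(\<integral>x. f x \<partial>\<mu>) = (\<Sum>i<M. p i) * (\<integral>x. f x \<partial>\<mu>)" by (simp add: p1)
  also have "\<dots> = (\<Sum>i<M. p i * (\<integral>x. f (mul (a i) x) \<partial>\<mu>))"
    using integral_translate[OF haar grp contl borel_measurable_of_continuous[OF sets f]]
    by (simp add: sum_distrib_right)
  also have "\<dots> = (\<integral>x. \<phi> x \<partial>\<mu>)"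
    unfolding \<phi>_def using intf by (subst Bochner_Integration.integral_sum) auto
  also have "\<dots> \<le> (\<integral>x. C + \<epsilon> \<partial>\<mu>)"
    using upper intf unfolding \<phi>_def by (intro integral_mono) auto
  also have "\<dots> = C + \<epsilon>" using prob_space by (simp add: space)
  finally have "(\<integral>x. f x \<partial>\<mu>) - 2 * \<epsilon> \<le> \<phi> x" for x using lower[of x] by simp
  then show ?thesis using that[of p M] p1 by (simp add: p_def \<phi>_def)
qed

text \<open>The real weights \<open>p i\<close> become multiplicities: index \<open>i\<close> is
  repeated \<open>n i\<close> times in \<open>gs\<close>, with \<open>n i\<close> the integer part
  of \<open>K * p i\<close>. As \<open>f\<close> lies below the indicator of \<open>U\<close>, the
  weighted sum of \<open>f\<close> bounds the count from below.\<close>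

lemma ex_counting_certificate:
  fixes mul :: "'a::metric_space \<Rightarrow> 'a \<Rightarrow> 'a" and a :: "nat \<Rightarrow> 'a"
  assumes haar: "haar_prob_measure mul \<mu>" and grp: "group mul e iv"
    and comp: "compact (UNIV :: 'a set)" and cont: "continuous_on UNIV (\<lambda>(x, y). mul x y)"
    and dense: "closure (range a) = UNIV" and U: "open U" and r: "0 \<le> r" "r < measure \<mu> U"
  obtains gs m where "gs \<noteq> []" "r * length gs < real m"
    "\<And>x. m \<le> (\<Sum>i<length gs. of_bool (mul (a (gs ! i)) x \<in> U))"
proof -
  obtain f where f: "continuous_on UNIV f" "\<And>x. 0 \<le> f x" "\<And>x. f x \<le> of_bool (x \<in> U)"
    "r < (\<integral>x. f x \<partial>\<mu>)"
    using ex_continuous_below_indicator[OF _ _ U r(2)] haar by (auto simp: haar_prob_measure_def)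
  \<comment> \<open>Of the four quarters of the gap, two are lost in \<open>ex_weights\<close>, one
    in rounding, and the last keeps the inequality strict.\<close>
  define \<epsilon> where "\<epsilon> = ((\<integral>x. f x \<partial>\<mu>) - r) / 4"
  have "0 < \<epsilon>" using f(4) by (simp add: \<epsilon>_def)
  obtain p M where p: "\<And>i. 0 \<le> p i" "(\<Sum>i<M::nat. p i) = 1"
    "\<And>x. (\<integral>x. f x \<partial>\<mu>) - 2 * \<epsilon> \<le> (\<Sum>i<M. p i * f (mul (a i) x))"
    using ex_weights[OF haar grp comp cont dense f(1) \<open>0 < \<epsilon>\<close>] by metis
  \<comment> \<open>Rounding costs at most 1 for each of the \<open>M\<close> indices; this
    \<open>K\<close> makes the total at most \<open>K * \<epsilon>\<close>.\<close>
  define K where "K = Suc (nat \<lceil>real M / \<epsilon>\<rceil>)"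
  have "real M / \<epsilon> \<le> real K" unfolding K_def by linarith
  then have K: "real M \<le> real K * \<epsilon>" using \<open>0 < \<epsilon>\<close> by (simp add: field_simps)
  have K0: "0 < K" by (simp add: K_def)
  define n where "n = (\<lambda>i. nat \<lfloor>real K * p i\<rfloor>)"
  have n: "real (n i) \<le> real K * p i" "real K * p i - 1 \<le> real (n i)" for i
    using p(1)[of i] unfolding n_def by simp_all
  define gs where "gs = concat (map (\<lambda>i. replicate (n i) i) [0..<M])"
  have "length gs = (\<Sum>i<M. n i)"
    using sum_nth_concat_replicate[of "\<lambda>_. 1" n M] by (simp add: gs_def)
  then have "real (length gs) \<le> (\<Sum>i<M. real K * p i)" using n by (simp add: sum_mono)
  also have "\<dots> = K" by (simp add: sum_distrib_left[symmetric] p(2))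
  finally have len: "real (length gs) \<le> real K" .
  define N where "N = (\<lambda>x. \<Sum>i<length gs. of_bool (mul (a (gs ! i)) x \<in> U) :: nat)"
  have N: "real K * (r + \<epsilon>) \<le> real (N x)" for x
  proof -
    have f1: "f y \<le> 1" for y using f(3)[of y] by (auto split: if_splits simp: of_bool_def)
    have "real K * (r + 2 * \<epsilon>) = real K * ((\<integral>x. f x \<partial>\<mu>) - 2 * \<epsilon>)"
      by (simp add: \<epsilon>_def field_simps)
    also have "\<dots> \<le> real K * (\<Sum>i<M. p i * f (mul (a i) x))"
      by (intro mult_left_mono p(3)) simp
    also have "\<dots> = (\<Sum>i<M. (real K * p i) * f (mul (a i) x))"
      by (simp add: sum_distrib_left mult.assoc)
    also have "\<dots> \<le> (\<Sum>i<M. real (n i) * of_bool (mul (a i) x \<in> U) + 1)"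
    proof (intro sum_mono)
      fix i
      let ?y = "mul (a i) x"
      have "(real K * p i) * f ?y \<le> (real (n i) + 1) * f ?y"
        using n(2)[of i] f(2) by (intro mult_right_mono) auto
      also have "\<dots> = real (n i) * f ?y + f ?y" by (simp add: algebra_simps)
      also have "\<dots> \<le> real (n i) * of_bool (?y \<in> U) + 1"
        using f(3)[of ?y] f1 by (intro add_mono mult_left_mono) auto
      finally show "(real K * p i) * f ?y \<le> real (n i) * of_bool (?y \<in> U) + 1" .
    qed
    also have "\<dots> = real (N x) + M"
      unfolding N_def gs_def
      by (subst sum_nth_concat_replicate[of "\<lambda>j. of_bool (mul (a j) x \<in> U)"])
        (simp add: sum.distrib del: sum_of_bool_mult_eq sum_mult_of_bool_eq)
    finally show ?thesis using K by (simp add: algebra_simps)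
  qed
  define m where "m = nat \<lceil>real K * (r + \<epsilon>)\<rceil>"
  have pos: "0 < real K * (r + \<epsilon>)" using K0 r(1) \<open>0 < \<epsilon>\<close> by simp
  have "m \<le> N x" for x using N[of x] unfolding m_def by linarith
  moreover have "r * length gs < real m"
  proof -
    have "r * length gs \<le> r * K" using len r(1) by (intro mult_left_mono) auto
    also have "\<dots> < real K * (r + \<epsilon>)" using K0 \<open>0 < \<epsilon>\<close> by (simp add: algebra_simps)
    also have "\<dots> \<le> real m" unfolding m_def by linarith
    finally show ?thesis .
  qed
  moreover have "gs \<noteq> []" using N[of undefined] pos by (auto simp: N_def)
  ultimately show ?thesis using that[of gs m] by (simp add: N_def)
qed


section \<open>Testing translates of an open set\<close>

text \<open>For \<open>v\<close> a prefix of a name of \<open>x\<close>, this says that the part of the name of \<open>a g \<cdot> x\<close> computed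
  by \<open>d\<close> from \<open>v\<close> is accepted by the name \<open>u\<close> of an open set. The bounds ensure that only the
  values of \<open>u\<close> below \<open>length v\<close> matter.\<close>

definition hits :: "prog \<Rightarrow> baire \<Rightarrow> nat \<Rightarrow> nat list \<Rightarrow> bool" where
  "hits d u g v \<longleftrightarrow> (\<exists>s<length v. accepts u (pfst s) (list_decode (psnd s)) \<and>
     (\<forall>i<length (list_decode (psnd s)).
        bev d (length v) (interleave (\<lambda>_. g) (nth0 v)) [i] = Suc (nth0 (list_decode (psnd s)) i)))"

definition translate_test :: "prog \<Rightarrow> baire \<Rightarrow> nat list \<Rightarrow> nat \<Rightarrow> baire" where
  "translate_test d u gs m =
     wait_assoc 0 (\<lambda>v. m \<le> (\<Sum>i<length gs. of_bool (hits d u (nth0 gs i) v)))"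

text \<open>A run bounded by \<open>k\<close> reads only oracle entries below \<open>k\<close>, so
  the zero padding of the prefix is never seen.\<close>

lemma bev_interleave_prefix:
  "bev d k (interleave p (nth0 (map v [0..<k]))) xs = bev d k (interleave p v) xs"
  by (rule bev_cong) (auto simp: interleave_def nth0_def)

lemma hits_prefix_iff:
  "hits d u g (map v [0..<k]) \<longleftrightarrow> (\<exists>s<k. accepts u (pfst s) (list_decode (psnd s)) \<and>
     (\<forall>i<length (list_decode (psnd s)).
        bev d k (interleave (\<lambda>_. g) v) [i] = Suc (nth0 (list_decode (psnd s)) i)))"
  by (simp add: hits_def bev_interleave_prefix)

lemma accepts_cong:
  assumes "\<And>i. i \<le> pair n (list_encode w) \<Longrightarrow> u i = u' i"
  shows "accepts u n w = accepts u' n w"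
  using assms pair_mono[OF order_refl list_encode_take_le] by (simp add: accepts_def)

lemma hits_cong:
  assumes "\<And>i. i < length v \<Longrightarrow> u i = u' i"
  shows "hits d u g v = hits d u' g v"
proof -
  have "accepts u (pfst s) (list_decode (psnd s)) = accepts u' (pfst s) (list_decode (psnd s))"
    if "s < length v" for s
    by (rule accepts_cong) (use that assms in simp)
  then show ?thesis unfolding hits_def by (metis (no_types, lifting))
qed

text \<open>A list is at most as long as its code, so the prefix judged at \<open>z\<close> has
  length at most \<open>z\<close> and \<open>hits\<close> inspects \<open>u\<close> only below that
  length.\<close>

lemma translate_test_cong:
  assumes "\<And>i. i < N \<Longrightarrow> u i = u' i" "z < N"
  shows "translate_test d u gs m z = translate_test d u' gs m z"
proof -
  have "length (list_decode (psnd z)) \<le> z"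
    using length_le_list_encode[of "list_decode (psnd z)"] le_pair(2)[of "psnd z" "pfst z"] by simp
  then have "hits d u g (list_decode (psnd z)) = hits d u' g (list_decode (psnd z))" for g
    using assms by (intro hits_cong) simp
  then show ?thesis by (simp add: translate_test_def wait_assoc_def)
qed

section \<open>Computability and correctness of the translate test\<close>

lemma tcomp_div2 [tcomp_intros]:
  assumes "tcomp f" shows "tcomp (\<lambda>x. f x div 2)"
proof -
  have "tcomp (\<lambda>x. \<Sum>i<f x. of_bool (Suc i + Suc i \<le> f x))"
    by (intro tcomp_intros assms tcomp_comp[OF assms])
  moreover have "(\<Sum>i<n. of_bool (Suc i + Suc i \<le> n)) = n div 2" for n :: nat
  proof -
    have "{..<n} \<inter> {i. Suc i + Suc i \<le> n} = {..<n div 2}" by auto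
    then show ?thesis by (simp add: of_bool_def sum.If_cases)
  qed
  ultimately show ?thesis by simp
qed

lemma tcomp_of_bool_even [tcomp_intros]:
  assumes "tcomp f" shows "tcomp (\<lambda>x. of_bool (even (f x)))"
proof -
  have "even n \<longleftrightarrow> n div 2 + n div 2 = n" for n :: nat by presburger
  then show ?thesis by (simp only:) (intro tcomp_intros assms)
qed

lemma tcomp_take [tcomp_intros]:
  assumes "tcomp I" "tcomp L"
  shows "tcomp (\<lambda>x. list_encode (take (I x) (list_decode (L x))))"
proof -
  have "tcomp (\<lambda>x. list_encode (map (nth0 (list_decode (L x)))
      [0..<if I x \<le> length (list_decode (L x)) then I x else length (list_decode (L x))]))"
    by (intro tcomp_intros assms tcomp_comp[OF assms(2)])
  moreover have "map (nth0 xs) [0..<if i \<le> length xs then i else length xs] = take i xs" for xs i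
    by (cases "i \<le> length xs") (auto simp: nth0_def intro!: nth_equalityI)
  ultimately show ?thesis by simp
qed

lemma tcomp_of_bool_accepts [tcomp_intros]:
  assumes "tcomp P" "tcomp N" "tcomp L"
  shows "tcomp (\<lambda>x. of_bool (accepts (nth0 (list_decode (P x))) (N x) (list_decode (L x))))"
  unfolding accepts_def list_decode_inverse
  by (intro tcomp_intros assms assms[THEN tcomp_comp])

lemma tcomp_bev_interleave [tcomp_intros]:
  assumes "tcomp T" "tcomp G" "tcomp V" "tcomp (\<lambda>x. list_encode (L x))"
  shows "tcomp (\<lambda>x. bev d (T x) (interleave (\<lambda>_. G x) (nth0 (list_decode (V x)))) (L x))"
proof -
  define h where "h = (\<lambda>e. interleave (\<lambda>_. pfst e) (nth0 (list_decode (psnd e))))"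
  have "tcomp (\<lambda>z. h (pfst z) (psnd z))"
    unfolding h_def interleave_def by (intro tcomp_intros)
  from tcomp_bev[OF this assms(1) tcomp_pair[OF assms(2,3)] assms(4)]
  show ?thesis by (simp add: h_def)
qed

lemma tcomp_of_bool_hits [tcomp_intros]:
  assumes "tcomp P" "tcomp G" "tcomp V"
  shows "tcomp (\<lambda>x. of_bool (hits d (nth0 (list_decode (P x))) (G x) (list_decode (V x))))"
proof -
  have nil: "tcomp (\<lambda>x. list_encode [])" by (intro tcomp_intros)
  show ?thesis unfolding hits_def
    by (intro tcomp_intros nil assms assms[THEN tcomp_comp])
qed

lemma tcomp_translate_test:
  assumes "tcomp P" "tcomp G" "tcomp M" "tcomp Z"
  shows "tcomp (\<lambda>x. translate_test d (nth0 (list_decode (P x))) (list_decode (G x)) (M x) (Z x))"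
  unfolding translate_test_def wait_assoc_def
  by (intro tcomp_intros assms assms[THEN tcomp_comp])

text \<open>Hits are sound at every prefix length, and each translate lying in \<open>U\<close> is
  hit at all sufficiently large lengths; hence one length catches all of the finitely many
  translates.\<close>

lemma open_rep_translate_test:
  fixes a :: "nat \<Rightarrow> 'a::metric_space"
  assumes dense: "closure (range a) = UNIV"
    and d: "\<And>p z. prod_rep (metric_rep a) (metric_rep a) p = Some z \<Longrightarrow>
      \<exists>q. (\<forall>n. ev d p [n] = Some (q n)) \<and> metric_rep a q = Some (mul (fst z) (snd z))"
    and U: "open_rep (metric_rep a) u = Some U"
  shows "open_rep (metric_rep a) (translate_test d u gs m) =
    Some {x. m \<le> (\<Sum>i<length gs. of_bool (mul (a (nth0 gs i)) x \<in> U))}"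
  unfolding translate_test_def
proof (rule open_rep_wait_assoc[OF ran_metric_rep[OF dense]])
  fix v x assume v: "metric_rep a v = Some x"
  \<comment> \<open>The constant sequence \<open>g\<close> is a name of \<open>a g\<close>.\<close>
  have q: "\<exists>q. (\<forall>n. ev d (interleave (\<lambda>_. g) v) [n] = Some (q n)) \<and>
      metric_rep a q = Some (mul (a g) x)" for g
    using d[OF prod_rep_interleave[of "metric_rep a" "\<lambda>_. g" "a g" "metric_rep a", OF _ v]]
    by (simp add: metric_rep_iff)
  have sound: "mul (a g) x \<in> U" if hit: "hits d u g (map v [0..<k])" for g k
  proof -
    obtain q where q: "\<And>n. ev d (interleave (\<lambda>_. g) v) [n] = Some (q n)"
      "metric_rep a q = Some (mul (a g) x)" using q by blast
    from hit obtain n w where w: "accepts u n w"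
      "\<And>i. i < length w \<Longrightarrow> bev d k (interleave (\<lambda>_. g) v) [i] = Suc (nth0 w i)"
      unfolding hits_prefix_iff by auto
    have "w = map q [0..<length w]"
      using bev_sound[OF w(2)] q(1) by (intro nth_equalityI) (auto simp: nth0_def)
    then show ?thesis
      using accepts_prefix_iff[OF ran_metric_rep[OF dense] U q(2)] w(1) by metis
  qed
  have complete: "\<forall>\<^sub>F k in sequentially. hits d u g (map v [0..<k])" if inU: "mul (a g) x \<in> U" for g
  proof -
    obtain q where q: "\<And>n. ev d (interleave (\<lambda>_. g) v) [n] = Some (q n)"
      "metric_rep a q = Some (mul (a g) x)" using q by blast
    obtain n j where acc: "accepts u n (map q [0..<j])"
      using accepts_prefix_iff[OF ran_metric_rep[OF dense] U q(2)] inU by blast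
    have "\<forall>\<^sub>F k in sequentially. \<forall>i\<in>{..<j}. bev d k (interleave (\<lambda>_. g) v) [i] = Suc (q i)"
      by (intro eventually_ball_finite ballI bev_complete q(1)) simp
    moreover note eventually_gt_at_top[of "pair n (list_encode (map q [0..<j]))"]
    ultimately show ?thesis
    proof eventually_elim
      case (elim k)
      then show ?case
        unfolding hits_prefix_iff using acc
        by (intro exI[of _ "pair n (list_encode (map q [0..<j]))"]) (auto simp: nth0_def)
    qed
  qed
  let ?hit = "\<lambda>k i. hits d u (nth0 gs i) (map v [0..<k])"
  let ?in = "\<lambda>i. mul (a (nth0 gs i)) x \<in> U"
  have le: "(\<Sum>i<length gs. of_bool (?hit k i)) \<le> (\<Sum>i<length gs. of_bool (?in i) :: nat)" for k
    using sound by (intro sum_mono) (auto simp: of_bool_def)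
  have "\<forall>\<^sub>F k in sequentially. \<forall>i\<in>{..<length gs}. ?in i \<longrightarrow> ?hit k i"
    using complete by (intro eventually_ball_finite) (auto elim: eventually_mono)
  then obtain k where "\<forall>i\<in>{..<length gs}. ?in i \<longrightarrow> ?hit k i"
    by (auto simp: eventually_sequentially)
  then have "(\<Sum>i<length gs. of_bool (?in i) :: nat) \<le> (\<Sum>i<length gs. of_bool (?hit k i))"
    by (intro sum_mono) (auto simp: of_bool_def)
  then show "(\<exists>n. m \<le> (\<Sum>i<length gs. of_bool (?hit (n + 0) i))) =
      (x \<in> {x. m \<le> (\<Sum>i<length gs. of_bool (mul (a (nth0 gs i)) x \<in> U))})"
    using le le_trans by (simp only: mem_Collect_eq add_0_right) blast
qed


section \<open>A computable name of Haar measure\<close>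

text \<open>The output with index \<open>(gs, m, N)\<close> is the rational \<open>m / length gs\<close> if the program \<open>c\<close> for
  compactness confirms within the bound \<open>N\<close> that every point is moved into the open set by at
  least \<open>m\<close> of the elements \<open>gs\<close>, and \<open>0\<close> otherwise.\<close>

definition confirmed :: "prog \<Rightarrow> prog \<Rightarrow> baire \<Rightarrow> nat \<Rightarrow> bool" where
  "confirmed c d u n \<longleftrightarrow> (\<exists>i<psnd (psnd n).
     2 \<le> bev c (psnd (psnd n)) (translate_test d u (list_decode (pfst n)) (pfst (psnd n))) [i])"

definition haar_output :: "prog \<Rightarrow> prog \<Rightarrow> baire \<Rightarrow> nat \<Rightarrow> nat" where
  "haar_output c d u n = (if confirmed c d u n
     then pair (pfst (psnd n) + pfst (psnd n)) (length (list_decode (pfst n)) - 1) else pair 0 0)"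

text \<open>Index \<open>(gs, m, N)\<close> is answered as soon as \<open>N\<close> entries of the
  name of \<open>U\<close> are available, whether or not the confirmation succeeds. By
  \<open>haar_output_cong\<close> the padded prefix gives the same answer as the full name.\<close>

definition haar_assoc :: "prog \<Rightarrow> prog \<Rightarrow> baire" where
  "haar_assoc c d z = (if length (list_decode (psnd z)) < psnd (psnd (pfst z)) then 0
     else Suc (haar_output c d (nth0 (list_decode (psnd z))) (pfst z)))"

text \<open>Nonnegative integers have even codes and denominators are stored minus one; hence the
  doubled numerator and the decreased length in \<open>haar_output\<close>.\<close>

lemma rat_seq_pair: "rat_seq (pair (m + m) k) = real m / real (Suc k)"
proof -
  have "int_decode (m + m) = int m"
    using int_encode_inverse[of "int m"] by (simp add: int_encode_def sum_encode_def mult_2)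
  then show ?thesis by (simp add: rat_seq_def pair_def)
qed

lemma tcomp_haar_assoc: "tcomp (haar_assoc c d)"
proof -
  define h where "h = (\<lambda>e. translate_test d (nth0 (list_decode (pfst e)))
    (list_decode (pfst (psnd e))) (psnd (psnd e)))"
  have h: "tcomp (\<lambda>z. h (pfst z) (psnd z))"
    unfolding h_def by (intro tcomp_translate_test tcomp_intros)
  have "tcomp (\<lambda>x. bev c (psnd (psnd (N x))) (translate_test d (nth0 (list_decode (P x)))
    (list_decode (pfst (N x))) (pfst (psnd (N x)))) [I x])"
    if "tcomp P" "tcomp N" "tcomp I" for P N I
  proof -
    have nil: "tcomp (\<lambda>x. list_encode [])" by (intro tcomp_intros)
    have "tcomp (\<lambda>x. bev c (psnd (psnd (N x)))
      (h (pair (P x) (pair (pfst (N x)) (pfst (psnd (N x)))))) [I x])"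
      by (intro tcomp_bev[OF h] tcomp_intros that nil)
    then show ?thesis by (simp add: h_def)
  qed
  note bev = this
  have "tcomp (\<lambda>z. of_bool (confirmed c d (nth0 (list_decode (psnd z))) (pfst z)))"
    unfolding confirmed_def by (intro bev tcomp_intros)
  then show ?thesis unfolding haar_assoc_def haar_output_def
    by (intro tcomp_intros)
qed

lemma haar_output_cong:
  assumes "\<And>i. i < psnd (psnd n) \<Longrightarrow> u i = u' i"
  shows "haar_output c d u n = haar_output c d u' n"
proof -
  have "bev c (psnd (psnd n)) (translate_test d u gs m) xs
      = bev c (psnd (psnd n)) (translate_test d u' gs m) xs" for gs m xs
    by (intro bev_cong translate_test_cong[OF assms])
  then show ?thesis by (simp add: haar_output_def confirmed_def)
qed

lemma assoc_app_haar_assoc: "assoc_app (haar_assoc c d) p n = Some (haar_output c d p n)"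
proof -
  define N where "N = psnd (psnd n)"
  define w where "w = (\<lambda>k. haar_assoc c d (pair n (list_encode (map p [0..<k]))))"
  have w: "w k = (if k < N then 0 else Suc (haar_output c d (nth0 (map p [0..<k])) n))" for k
    by (simp add: w_def haar_assoc_def N_def)
  have "(LEAST k. w k \<noteq> 0) = N"
    by (intro Least_equality) (auto simp: w split: if_splits)
  moreover have "w N \<noteq> 0" by (simp add: w)
  moreover have "assoc_app (haar_assoc c d) p n
      = (if \<exists>k. w k \<noteq> 0 then Some (w (LEAST k. w k \<noteq> 0) - 1) else None)"
    by (simp add: assoc_app_def w_def pair_def Let_def)
  ultimately have "assoc_app (haar_assoc c d) p n = Some (w N - 1)" by auto
  also have "w N - 1 = haar_output c d p n"
    unfolding w using haar_output_cong[of n "nth0 (map p [0..<N])" p] by (simp add: nth0_def N_def)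
  finally show ?thesis .
qed

text \<open>A name determines the measure on open sets, an intersection-stable generator of the
  Borel sets, and so determines the measure.\<close>

lemma prob_measure_rep_iff:
  fixes \<delta> :: "'a::topological_space rep"
  assumes "ran (open_rep \<delta>) = {U. open U}"
  shows "prob_measure_rep \<delta> u = Some \<mu> \<longleftrightarrow> prob_space \<mu> \<and> sets \<mu> = sets borel \<and>
     fun_rep (open_rep \<delta>) lower_real_rep u =
       Some (restrict (\<lambda>U. measure \<mu> U) (ran (open_rep \<delta>)))"
  unfolding prob_measure_rep_def
proof (rule rep_of_eq_Some_iff, elim conjE)
  fix p and \<mu> \<nu> :: "'a measure"
  assume \<mu>: "prob_space \<mu>" "sets \<mu> = sets borel" and \<nu>: "prob_space \<nu>" "sets \<nu> = sets borel"
    and eq: "fun_rep (open_rep \<delta>) lower_real_rep p =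
       Some (restrict (\<lambda>U. measure \<mu> U) (ran (open_rep \<delta>)))"
      "fun_rep (open_rep \<delta>) lower_real_rep p =
       Some (restrict (\<lambda>U. measure \<nu> U) (ran (open_rep \<delta>)))"
  interpret M: prob_space \<mu> by fact
  interpret N: prob_space \<nu> by fact
  from eq have "restrict (\<lambda>U. measure \<mu> U) {U. open U} = restrict (\<lambda>U. measure \<nu> U) {U. open U}"
    by (simp add: assms)
  then have meq: "measure \<mu> U = measure \<nu> U" if "open U" for U
    using that by (metis (mono_tags) mem_Collect_eq restrict_apply')
  show "\<mu> = \<nu>"
  proof (rule measure_eqI_generator_eq[where E = "{U. open U}" and \<Omega> = UNIV and A = "\<lambda>_. UNIV"])
    show "Int_stable {U :: 'a set. open U}" by (auto simp: Int_stable_def)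
    show "emeasure \<mu> X = emeasure \<nu> X" if "X \<in> {U. open U}" for X
      using that meq by (simp add: M.emeasure_eq_measure N.emeasure_eq_measure)
  qed (use \<mu>(2) \<nu>(2) in \<open>auto simp: borel_def\<close>)
qed

theorem theorem1:
  fixes a :: "nat \<Rightarrow> 'a::complete_space"
    and mul :: "'a \<Rightarrow> 'a \<Rightarrow> 'a"
    and e :: 'a
    and inv :: "'a \<Rightarrow> 'a"
    and \<mu> :: "'a measure"
  assumes "computable_metric_space a"
    and "computably_compact (metric_rep a)"
    and "computable_map (prod_rep (metric_rep a) (metric_rep a)) (metric_rep a)
           (\<lambda>(x, y). mul x y)"
    and "group mul e inv"
    and "haar_prob_measure mul \<mu>"
  shows "computable_point (prob_measure_rep (metric_rep a)) \<mu>"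
proof -
  have dense: "closure (range a) = UNIV" using assms(1) by (simp add: computable_metric_space_def)
  have comp: "compact (UNIV :: 'a set)" by (rule compact_of_computably_compact[OF dense assms(2)])
  have cont: "continuous_on UNIV (\<lambda>(x, y). mul x y)"
    by (rule continuous_of_computable[OF dense assms(3)])
  have contl: "continuous_on UNIV (mul g)" for g
    using continuous_on_compose2[OF cont, of UNIV "\<lambda>x. (g, x)"] by (simp add: continuous_on_Pair)
  obtain c where c: "\<And>p U. open_rep (metric_rep a) p = Some U \<Longrightarrow>
      \<exists>q. (\<forall>n. ev c p [n] = Some (q n)) \<and> (\<exists>n. q n \<noteq> 0) = (U = UNIV)"
    using assms(2) unfolding computably_compact_def computable_map_def sierpinski_rep_def
      ran_metric_rep[OF dense] by auto
  obtain d where d: "\<And>p z. prod_rep (metric_rep a) (metric_rep a) p = Some z \<Longrightarrow>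
      \<exists>q. (\<forall>n. ev d p [n] = Some (q n)) \<and> metric_rep a q = Some (mul (fst z) (snd z))"
    using assms(3) unfolding computable_map_def case_prod_beta by blast
  have "lower_real_rep (haar_output c d p) = Some (measure \<mu> U)"
    if p: "open_rep (metric_rep a) p = Some U" for p U
  proof -
    have "open U" by (rule open_of_open_rep[OF dense p])
    define W where "W = (\<lambda>gs m. {x. (m :: nat) \<le> (\<Sum>i<length gs. of_bool (mul (a (nth0 gs i)) x \<in> U))})"
    have W: "\<exists>q. (\<forall>n. ev c (translate_test d p gs m) [n] = Some (q n)) \<and>
        (\<exists>n. q n \<noteq> 0) = (W gs m = UNIV)" for gs m
      unfolding W_def by (rule c[OF open_rep_translate_test[where mul = mul, OF dense d p]])
    have le: "rat_seq (haar_output c d p n) \<le> measure \<mu> U" for n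
    proof (cases "confirmed c d p n")
      case True
      define gs m N where "gs = list_decode (pfst n)" and "m = pfst (psnd n)" and "N = psnd (psnd n)"
      from True obtain i where "2 \<le> bev c N (translate_test d p gs m) [i]"
        by (auto simp: confirmed_def gs_def m_def N_def)
      then obtain y where "bev c N (translate_test d p gs m) [i] = Suc y" "y \<noteq> 0"
        by (cases "bev c N (translate_test d p gs m) [i]") auto
      with W[of gs m] bev_sound have "W gs m = UNIV" by (metis option.inject)
      then have "real m \<le> real (length gs) * measure \<mu> U"
        by (intro haar_measure_ge[where g = "\<lambda>i. a (nth0 gs i)",
            OF assms(5,4) contl \<open>open U\<close>])
          (auto simp: W_def)
      \<comment> \<open>The coded denominator exceeds \<open>length gs\<close> only for the empty
        list, where it is 1.\<close>
      moreover have "real (length gs) * measure \<mu> U \<le> real (Suc (length gs - 1)) * measure \<mu> U"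
        by (intro mult_right_mono) auto
      ultimately have "real m / real (Suc (length gs - 1)) \<le> measure \<mu> U"
        by (simp add: divide_le_eq mult.commute del: of_nat_Suc)
      then show ?thesis
        using True by (simp only: haar_output_def if_True rat_seq_pair gs_def m_def)
    next
      case False
      then show ?thesis using rat_seq_pair[of 0 0] by (simp add: haar_output_def)
    qed
    have ex: "\<exists>n. r < rat_seq (haar_output c d p n)" if r: "0 \<le> r" "r < measure \<mu> U" for r
    proof -
      obtain gs m where gs: "gs \<noteq> []" "r * length gs < real m"
        "\<And>x. m \<le> (\<Sum>i<length gs. of_bool (mul (a (gs ! i)) x \<in> U))"
        using ex_counting_certificate[OF assms(5,4) comp cont dense \<open>open U\<close> r] by metis
      have "W gs m = UNIV" using gs(3) by (auto simp: W_def nth0_def)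
      with W[of gs m] obtain i y where "ev c (translate_test d p gs m) [i] = Some y" "y \<noteq> 0"
        by auto
      from eventually_conj[OF bev_complete[OF this(1)] eventually_gt_at_top[of i]] this(2)
      obtain N where "bev c N (translate_test d p gs m) [i] = Suc y" "i < N" "y \<noteq> 0"
        by (auto simp: eventually_sequentially)
      then have "confirmed c d p (pair (list_encode gs) (pair m N))"
        by (auto simp: confirmed_def intro!: exI[of _ i])
      then have "rat_seq (haar_output c d p (pair (list_encode gs) (pair m N)))
          = real m / real (Suc (length gs - 1))"
        by (simp add: haar_output_def rat_seq_pair)
      also have "Suc (length gs - 1) = length gs" using gs(1) by (cases gs) auto
      finally have "rat_seq (haar_output c d p (pair (list_encode gs) (pair m N)))
          = real m / real (length gs)" .
      moreover have "r < real m / real (length gs)" using gs(1,2) by (simp add: less_divide_eq)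
      ultimately show ?thesis by metis
    qed
    have nonneg: "0 \<le> rat_seq (haar_output c d p n)" for n
      by (simp only: haar_output_def rat_seq_pair[of 0, simplified] rat_seq_pair split: if_splits)
         (simp add: rat_seq_pair)
    have bdd: "bdd_above (range (\<lambda>n. rat_seq (haar_output c d p n)))"
      by (rule bdd_aboveI2[OF le])
    have "measure \<mu> U \<le> (SUP n. rat_seq (haar_output c d p n))"
    proof (rule dense_le)
      fix r assume r: "r < measure \<mu> U"
      show "r \<le> (SUP n. rat_seq (haar_output c d p n))"
      proof (cases "0 \<le> r")
        case True
        then obtain n where "r < rat_seq (haar_output c d p n)" using ex r by blast
        then show ?thesis using cSUP_upper[OF UNIV_I bdd, of n] by linarith
      next
        \<comment> \<open>Certificates exist for nonnegative \<open>r\<close> only; below 0 any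
          output suffices.\<close>
        case False
        then show ?thesis using cSUP_upper[OF UNIV_I bdd, of 0] nonneg[of 0] by linarith
      qed
    qed
    moreover have "(SUP n. rat_seq (haar_output c d p n)) \<le> measure \<mu> U"
      using le by (intro cSUP_least) auto
    ultimately show ?thesis using bdd by (simp add: lower_real_rep_def)
  qed
  then have "fun_rep (open_rep (metric_rep a)) lower_real_rep (haar_assoc c d) =
      Some (restrict (\<lambda>U. measure \<mu> U) (ran (open_rep (metric_rep a))))"
    unfolding fun_rep_iff assoc_app_haar_assoc by (auto simp: ran_def)
  then have "prob_measure_rep (metric_rep a) (haar_assoc c d) = Some \<mu>"
    using assms(5) by (simp add: prob_measure_rep_iff[OF ran_open_rep[OF dense]] haar_prob_measure_def)
  moreover have "computable_seq (haar_assoc c d)"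
    using tcomp_haar_assoc unfolding tcomp_def computable_seq_def by blast
  ultimately show ?thesis unfolding computable_point_def by blast
qed

end
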